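(* Let the transformation operators $\mathcal{T}_1,\ldots,\mathcal{T}_r$ satisfy the following assumptions for every $i=1,\ldots,r$. (A1) For every $\varphi_i\in\mathscr{Y}$ and every $p_i\in\mathbb{R}$, $\mathcal{T}_i(p_i)\mathscr{Y}\subseteq\mathscr{Y}$, and the mapping $\mathbb{R}\to\mathscr{X}$, $p_i\mapsto\mathcal{T}_i(p_i)\varphi_i$, is continuous. (A2) For every $\alpha_i\in L^2(0,T)$, every $p_i\in H^1(0,T)$ and every $\varphi_i\in\mathscr{Y}$, one has $\alpha_i\mathcal{T}_i(p_i)\varphi_i\in L^2(0,T;\mathscr{X})$. (A3) For every $\varphi_i\in\mathscr{Y}$, the mapping $\mathbb{R}\to\mathscr{X}$, $p_i\mapsto\mathcal{T}_i(p_i)\varphi_i$, is continuously differentiable, with derivative at $p_i\in\mathbb{R}$ denoted $\frac{\partial}{\partial p_i}\mathcal{T}_i(p_i)\varphi_i\in\mathscr{X}$, and $\alpha_i\frac{\partial}{\partial p_i}\mathcal{T}_i(p_i)\varphi_i\in L^2(0,T;\mathscr{X})$ for all $\alpha_i\in L^2(0,T)$ and all $p_i\in H^1(0,T)$. Let $(\boldsymbol{\alpha},\boldsymbol{p},\boldsymbol{\varphi})\in\mathscr{Z}$ and assume that $$\mathcal{T}_i(p_i)\varphi_i\in L^\infty(0,T;\mathscr{X})\qquad\text{and}\qquad\alpha_i\|\mathcal{T}_i(p_i)\|\in L^2(0,T)\qquad\text{for }i=1,\ldots,r,$$ where $\|\cdot\|$ is the operator norm on $\mathscr{B}(\mathscr{X})$.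 Then $J$ is partially Fréchet differentiable at $(\boldsymbol{\alpha},\boldsymbol{p},\boldsymbol{\varphi})$ with respect to the coefficients, the paths, and the modes, and the partial Fréchet derivatives are given by $$\partial_{\boldsymbol{\alpha}}J(\boldsymbol{\alpha},\boldsymbol{p},\boldsymbol{\varphi})(\boldsymbol{d})=\sum_{i=1}^r\left\langle\sum_{j=1}^r\alpha_j\mathcal{T}_j(p_j)\varphi_j-z,\;d_i\mathcal{T}_i(p_i)\varphi_i\right\rangle_{L^2(0,T;\mathscr{X})}\quad\forall\,\boldsymbol{d}\in L^2(0,T;\mathbb{R}^r),$$ $$\partial_{\boldsymbol{p}}J(\boldsymbol{\alpha},\boldsymbol{p},\boldsymbol{\varphi})(\boldsymbol{g})=\sum_{i=1}^r\left\langle\sum_{j=1}^r\alpha_j\mathcal{T}_j(p_j)\varphi_j-z,\;\alpha_i\left[\tfrac{\partial}{\partial p_i}\mathcal{T}_i(p_i)\varphi_i\right]g_i\right\rangle_{L^2(0,T;\mathscr{X})}\quad\forall\,\boldsymbol{g}\in H^1(0,T;\mathbb{R}^r),$$ $$\partial_{\boldsymbol{\varphi}}J(\boldsymbol{\alpha},\boldsymbol{p},\boldsymbol{\varphi})(\boldsymbol{h})=\sum_{i=1}^r\left\langle\sum_{j=1}^r\alpha_j\mathcal{T}_j(p_j)\varphi_j-z,\;\alpha_i\mathcal{T}_i(p_i)h_i\right\rangle_{L^2(0,T;\mathscr{X})}\quad\forall\,\boldsymbol{h}\in\mathscr{Y}^r.$$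
   Context: Let $T>0$ and $r\in\mathbb{N}$. Let $(\mathscr{X},\langle\cdot,\cdot\rangle_{\mathscr{X}})$ be a real Hilbert space with induced norm $\|\cdot\|_{\mathscr{X}}$, and let $\mathscr{Y}$ be a dense subspace of $\mathscr{X}$ that is itself a reflexive Banach space with norm $\|\cdot\|_{\mathscr{Y}}$. The data satisfies $z\in L^2(0,T;\mathscr{Y})$. Let $\mathscr{B}(\mathscr{X})$ be the bounded linear operators on $\mathscr{X}$. For $i=1,\ldots,r$ let $\mathcal{T}_i\colon\mathbb{R}\to\mathscr{B}(\mathscr{X})$ be a family of bounded linear operators (no linearity in the parameter is assumed). For functions $\alpha_i,p_i$ of $t\in(0,T)$ and $\varphi_i\in\mathscr{Y}$, the expression $\alpha_i\mathcal{T}_i(p_i)\varphi_i$ denotes the function $t\mapsto\alpha_i(t)\,\mathcal{T}_i(p_i(t))\varphi_i$, and similarly $\alpha_i\frac{\partial}{\partial p_i}\mathcal{T}_i(p_i)\varphi_i$ denotes $\alpha_i(t)$ times the derivative evaluated at $p_i(t)$, and $\alpha_i\|\mathcal{T}_i(p_i)\|$ denotes $t\mapsto\alpha_i(t)\|\mathcal{T}_i(p_i(t))\|$. $L^2(0,T;\mathscr{X})$ and $L^\infty(0,T;\mathscr{X})$ denote Bochner spaces. Set $$\mathscr{Z}:=L^2(0,T;\mathbb{R}^r)\times H^1(0,T;\mathbb{R}^r)\times\mathscr{Y}^r,$$ with elements $(\boldsymbol{\alpha},\boldsymbol{p},\boldsymbol{\varphi})$ (coefficients, paths, modes), where $\boldsymbol{\alpha}=(\alpha_1,\ldots,\alpha_r)$,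 $\boldsymbol{p}=(p_1,\ldots,p_r)$, $\boldsymbol{\varphi}=(\varphi_1,\ldots,\varphi_r)$; components of $\boldsymbol{d},\boldsymbol{g},\boldsymbol{h}$ are denoted $d_i,g_i,h_i$. The cost functional is $$J\colon\mathscr{Z}\to\mathbb{R},\qquad J(\boldsymbol{\alpha},\boldsymbol{p},\boldsymbol{\varphi})=\frac12\left\|z-\sum_{i=1}^r\alpha_i\mathcal{T}_i(p_i)\varphi_i\right\|_{L^2(0,T;\mathscr{X})}^2.$$ Partial Fréchet derivatives are taken with respect to the norms of $L^2(0,T;\mathbb{R}^r)$, $H^1(0,T;\mathbb{R}^r)$ and $\mathscr{Y}^r$, respectively.
   Formalization: The inclusion of 𝒴 into 𝒳 is additionally assumed continuous; without this, J need not be continuous in the modes (e.g. 𝒴 = 𝒳 with an inequivalent Hilbert norm and 𝒯_1 = Id). *)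

theory Defs
  imports "HOL-Analysis.Analysis"
begin

text \<open>Elements of the Bochner and Sobolev spaces are represented by functions on the real line
  of which only the values on (0,T) matter, almost everywhere. Accordingly \<open>norm_L2\<close> and
  \<open>norm_H1\<close> are seminorms on these representatives, and functions at distance zero represent the
  same class.

  The library's Bochner integral requires a second countable target. Here the target
  need not be separable, so strong measurability is spelled out; only real-valued integrals
  are needed for the norm and the inner product.\<close>

definition strongly_measurable :: "'m measure \<Rightarrow> ('m \<Rightarrow> 'a::real_normed_vector) \<Rightarrow> bool" where
  "strongly_measurable M f \<longleftrightarrow>
     (\<exists>s :: nat \<Rightarrow> 'm \<Rightarrow> 'a. (\<forall>n. simple_function M (s n)) \<and>
        (AE t in M. (\<lambda>n. s n t) \<longlonglongrightarrow> f t))"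

definition bochner_L2 :: "real \<Rightarrow> (real \<Rightarrow> 'a::real_normed_vector) set" where
  "bochner_L2 T = {f. strongly_measurable (lebesgue_on {0<..<T}) f \<and>
     integrable (lebesgue_on {0<..<T}) (\<lambda>t. (norm (f t))\<^sup>2)}"

definition bochner_Linf :: "real \<Rightarrow> (real \<Rightarrow> 'a::real_normed_vector) set" where
  "bochner_Linf T = {f. strongly_measurable (lebesgue_on {0<..<T}) f \<and>
     (\<exists>C. AE t in lebesgue_on {0<..<T}. norm (f t) \<le> C)}"

definition norm_L2 :: "real \<Rightarrow> (real \<Rightarrow> 'a::real_normed_vector) \<Rightarrow> real" where
  "norm_L2 T f = sqrt (LINT t|lebesgue_on {0<..<T}. (norm (f t))\<^sup>2)"

definition inner_L2 :: "real \<Rightarrow> (real \<Rightarrow> 'a::real_inner) \<Rightarrow> (real \<Rightarrow> 'a) \<Rightarrow> real" where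
  "inner_L2 T f g = (LINT t|lebesgue_on {0<..<T}. f t \<bullet> g t)"

text \<open>Test functions are the continuously differentiable functions with compact support in (0,T),
  as in Brezis' textbook definition of Sobolev spaces on intervals.\<close>

definition test_function :: "real \<Rightarrow> (real \<Rightarrow> real) \<Rightarrow> bool" where
  "test_function T \<psi> \<longleftrightarrow> \<psi> C1_differentiable_on UNIV \<and>
     (\<exists>a b. 0 < a \<and> a \<le> b \<and> b < T \<and> (\<forall>t. t \<notin> {a..b} \<longrightarrow> \<psi> t = 0))"

definition has_weak_derivative ::
  "real \<Rightarrow> (real \<Rightarrow> 'a::{banach, second_countable_topology}) \<Rightarrow> (real \<Rightarrow> 'a) \<Rightarrow> bool" where
  "has_weak_derivative T f g \<longleftrightarrow> (\<forall>\<psi>. test_function T \<psi> \<longrightarrow>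
     (LINT t|lebesgue_on {0<..<T}. deriv \<psi> t *\<^sub>R f t) =
     - (LINT t|lebesgue_on {0<..<T}. \<psi> t *\<^sub>R g t))"

definition sobolev_H1 :: "real \<Rightarrow> (real \<Rightarrow> 'a::{banach, second_countable_topology}) set" where
  "sobolev_H1 T = {f \<in> bochner_L2 T. \<exists>g \<in> bochner_L2 T. has_weak_derivative T f g}"

text \<open>The weak derivative is unique up to null sets, so the choice does not affect \<open>norm_H1\<close>.\<close>

definition weak_derivative ::
  "real \<Rightarrow> (real \<Rightarrow> 'a::{banach, second_countable_topology}) \<Rightarrow> real \<Rightarrow> 'a" where
  "weak_derivative T f = (SOME g. g \<in> bochner_L2 T \<and> has_weak_derivative T f g)"

definition norm_H1 ::
  "real \<Rightarrow> (real \<Rightarrow> 'a::{banach, second_countable_topology}) \<Rightarrow> real" where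
  "norm_H1 T f = sqrt ((norm_L2 T f)\<^sup>2 + (norm_L2 T (weak_derivative T f))\<^sup>2)"

text \<open>Since \<open>V\<close> is a space of representatives with seminorm \<open>N\<close>, depending on the term \<open>T\<close>, it is
  not a type of class \<^class>\<open>real_normed_vector\<close>. The following is \<^const>\<open>has_derivative\<close> at a
  point relative to such a space: \<open>D\<close> is linear and bounded on \<open>V\<close> and the remainder is little-o
  of \<open>N\<close>. In particular \<open>D\<close> vanishes on elements of seminorm zero.\<close>

definition has_frechet_derivative_in ::
  "((real \<Rightarrow> 'a::real_normed_vector) \<Rightarrow> real) \<Rightarrow> ((real \<Rightarrow> 'a) \<Rightarrow> real) \<Rightarrow> (real \<Rightarrow> 'a) \<Rightarrow>
   (real \<Rightarrow> 'a) set \<Rightarrow> ((real \<Rightarrow> 'a) \<Rightarrow> real) \<Rightarrow> bool" where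
  "has_frechet_derivative_in F D f V N \<longleftrightarrow> f \<in> V \<and>
     (\<forall>u\<in>V. \<forall>v\<in>V. D (\<lambda>t. u t + v t) = D u + D v) \<and>
     (\<forall>c. \<forall>u\<in>V. D (\<lambda>t. c *\<^sub>R u t) = c * D u) \<and>
     (\<exists>K. \<forall>u\<in>V. \<bar>D u\<bar> \<le> K * N u) \<and>
     (\<forall>\<epsilon>>0. \<exists>\<delta>>0. \<forall>u\<in>V. N u < \<delta> \<longrightarrow>
        \<bar>F (\<lambda>t. f t + u t) - F f - D u\<bar> \<le> \<epsilon> * N u)"

definition reflexive_space :: "'y::banach itself \<Rightarrow> bool" where
  "reflexive_space _ \<longleftrightarrow>
     (\<forall>F :: ('y \<Rightarrow>\<^sub>L real) \<Rightarrow>\<^sub>L real. \<exists>y :: 'y. \<forall>f. blinfun_apply F f = blinfun_apply f y)"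

text \<open>A dense subspace of \<open>'x\<close> carrying its own norm is given as a separate type \<open>'y\<close> with its
  inclusion map \<open>\<iota>\<close>. The inclusion is continuous with respect to the two norms; this is what makes
  square integrable functions into the subspace square integrable into \<open>'x\<close>.\<close>

definition dense_inclusion :: "('y::real_normed_vector \<Rightarrow> 'x::real_normed_vector) \<Rightarrow> bool" where
  "dense_inclusion \<iota> \<longleftrightarrow> bounded_linear \<iota> \<and> inj \<iota> \<and> closure (range \<iota>) = UNIV"

definition path_derivative ::
  "('y \<Rightarrow> 'x) \<Rightarrow> (real \<Rightarrow> 'x \<Rightarrow>\<^sub>L 'x) \<Rightarrow> real \<Rightarrow> 'y \<Rightarrow> 'x::real_normed_vector" where
  "path_derivative \<iota> \<T>\<^sub>i q \<phi> = vector_derivative (\<lambda>s. blinfun_apply (\<T>\<^sub>i s) (\<iota> \<phi>)) (at q)"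

definition ansatz ::
  "('y \<Rightarrow> 'x) \<Rightarrow> ('r \<Rightarrow> real \<Rightarrow> 'x \<Rightarrow>\<^sub>L 'x) \<Rightarrow>
   (real \<Rightarrow> real^'r::finite) \<Rightarrow> (real \<Rightarrow> real^'r) \<Rightarrow> 'y^'r \<Rightarrow> real \<Rightarrow> 'x::real_normed_vector" where
  "ansatz \<iota> \<T> \<alpha> p \<phi> =
     (\<lambda>t. \<Sum>i\<in>UNIV. (\<alpha> t $ i) *\<^sub>R blinfun_apply (\<T> i (p t $ i)) (\<iota> (\<phi> $ i)))"

definition cost ::
  "real \<Rightarrow> ('y \<Rightarrow> 'x::real_inner) \<Rightarrow> (real \<Rightarrow> 'y) \<Rightarrow> ('r \<Rightarrow> real \<Rightarrow> 'x \<Rightarrow>\<^sub>L 'x) \<Rightarrow>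
   (real \<Rightarrow> real^'r::finite) \<Rightarrow> (real \<Rightarrow> real^'r) \<Rightarrow> ('y^'r) \<Rightarrow> real" where
  "cost T \<iota> z \<T> \<alpha> p \<phi> = 1/2 * (norm_L2 T (\<lambda>t. \<iota> (z t) - ansatz \<iota> \<T> \<alpha> p \<phi> t))\<^sup>2"

end

theory Submission
  imports Defs
begin

text \<open>The cost is half the squared norm of a residual \<open>w\<close> in a space with an inner product. If a
  perturbation \<open>u\<close> of one argument changes the residual by \<open>\<Delta> u\<close>, and \<open>L\<close> is linear and bounded with
  \<open>\<parallel>\<Delta> u - L u\<parallel> = o(N u)\<close>, then \<open>u \<mapsto> \<langle>w, L u\<rangle>\<close> is the Frechet derivative by expanding the square
  and the Cauchy-Schwarz inequality. In the coefficients and in the modes \<open>\<Delta>\<close> is itself linear, and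
  the two integrability hypotheses at the base point make it bounded. For the paths, the embedding of \<open>H\<^sup>1\<close>
  into \<open>L\<^sup>\<infinity>\<close> confines the path to a compact interval and makes the perturbation uniformly small, so
  the uniform continuity of the derivatives of the transformations on compact intervals gives the
  remainder estimate.\<close>

section \<open>Strong measurability and Bochner spaces\<close>

text \<open>The square integrability of the products
  \<open>\<alpha>\<^sub>i \<T>\<^sub>i(p\<^sub>i) \<phi>\<^sub>i\<close> is assumed for each fixed
  triple and carries no bound that is uniform in a perturbation. For coefficients and modes such a
  bound has to come from the base point. For the paths it has to hold on a whole neighbourhood of
  \<open>p\<close>, so the embedding constant must not depend on the function it is applied to. A
  weak derivative is only an identity of integrals against test functions, and the embedding is
  extracted from it by duality: pairings of \<open>u\<close> with continuous functions supported
  inside (0,T) are bounded by the \<open>L\<^sup>1\<close> norm of those functions, the bound passes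
  to indicators of intervals, and shrinking the intervals recovers \<open>u\<close> almost
  everywhere. No continuous representative of \<open>u\<close> is constructed, since the cost sees a
  path only through integrals and an almost everywhere bound is enough. Functions with values in the
  possibly nonseparable space are never integrated themselves; only their norms and inner products
  are, and these are real-valued.\<close>

lemma strongly_measurable_const: "strongly_measurable M (\<lambda>t. c)"
  unfolding strongly_measurable_def by (rule exI[of _ "\<lambda>n t. c"]) simp

text \<open>Any map preserves simple functions, since they take finitely many values. Continuity is
  what carries the pointwise limit along.\<close>

lemma strongly_measurable_compose:
  assumes "strongly_measurable M f" and "continuous_on UNIV h"
  shows "strongly_measurable M (\<lambda>t. h (f t))"
proof -
  obtain s where s: "\<And>n. simple_function M (s n)" "AE t in M. (\<lambda>n. s n t) \<longlonglongrightarrow> f t"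
    using assms(1) unfolding strongly_measurable_def by blast
  have "AE t in M. (\<lambda>n. h (s n t)) \<longlonglongrightarrow> h (f t)"
    using s(2) by eventually_elim (rule continuous_on_tendsto_compose[OF assms(2)], auto)
  moreover have "simple_function M (\<lambda>t. h (s n t))" for n
    by (rule simple_function_compose1[OF s(1)])
  ultimately show ?thesis
    unfolding strongly_measurable_def by (intro exI[of _ "\<lambda>n t. h (s n t)"]) simp
qed

lemma strongly_measurable_Pair:
  assumes "strongly_measurable M f" and "strongly_measurable M g"
  shows "strongly_measurable M (\<lambda>t. (f t, g t))"
proof -
  obtain s where s: "\<And>n. simple_function M (s n)" "AE t in M. (\<lambda>n. s n t) \<longlonglongrightarrow> f t"
    using assms(1) unfolding strongly_measurable_def by blast
  obtain s' where s': "\<And>n. simple_function M (s' n)" "AE t in M. (\<lambda>n. s' n t) \<longlonglongrightarrow> g t"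
    using assms(2) unfolding strongly_measurable_def by blast
  have "AE t in M. (\<lambda>n. (s n t, s' n t)) \<longlonglongrightarrow> (f t, g t)"
    using s(2) s'(2) by eventually_elim (rule tendsto_Pair)
  moreover have "simple_function M (\<lambda>t. (s n t, s' n t))" for n
    by (rule simple_function_Pair[OF s(1) s'(1)])
  ultimately show ?thesis
    unfolding strongly_measurable_def by (intro exI[of _ "\<lambda>n t. (s n t, s' n t)"]) simp
qed

text \<open>Closure under sums, scalar multiples and inner products all reduce to one continuous map
  on the product space.\<close>

lemma strongly_measurable_compose2:
  assumes "strongly_measurable M f" and "strongly_measurable M g"
    and "continuous_on UNIV (\<lambda>x. h (fst x) (snd x))"
  shows "strongly_measurable M (\<lambda>t. h (f t) (g t))"
  using strongly_measurable_compose[OF strongly_measurable_Pair[OF assms(1,2)] assms(3)] by simp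

lemma strongly_measurable_add:
  assumes "strongly_measurable M f" and "strongly_measurable M g"
  shows "strongly_measurable M (\<lambda>t. f t + g t)"
  by (rule strongly_measurable_compose2[OF assms]) (intro continuous_intros)

lemma strongly_measurable_scaleR:
  assumes "strongly_measurable M f" and "strongly_measurable M g"
  shows "strongly_measurable M (\<lambda>t. f t *\<^sub>R g t)"
  by (rule strongly_measurable_compose2[OF assms]) (intro continuous_intros)

lemma strongly_measurable_inner:
  assumes "strongly_measurable M f" and "strongly_measurable M g"
  shows "strongly_measurable M (\<lambda>t. f t \<bullet> g t)"
  by (rule strongly_measurable_compose2[OF assms]) (intro continuous_intros)

text \<open>Completeness of Lebesgue measure makes the exceptional null set of the approximation
  harmless. This is the bridge from strong measurability to the integral: it is applied to norms and
  inner products, and to the coefficients and paths.\<close>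

lemma strongly_measurable_imp_borel_measurable:
  fixes f :: "'a::euclidean_space \<Rightarrow> 'b::euclidean_space"
  assumes f: "strongly_measurable (lebesgue_on S) f" and S: "S \<in> sets lebesgue"
  shows "f \<in> borel_measurable (lebesgue_on S)"
proof -
  obtain s where s: "\<And>n. simple_function (lebesgue_on S) (s n)"
      "AE t in lebesgue_on S. (\<lambda>n. s n t) \<longlonglongrightarrow> f t"
    using f unfolding strongly_measurable_def by blast
  \<comment> \<open>Extension by zero turns the statement into one about the full Lebesgue measure,
    where a function may be changed on a null set.\<close>
  define s' where "s' n t = (if t \<in> S then s n t else 0)" for n t
  have s'_meas: "s' n \<in> borel_measurable lebesgue" for n
    unfolding s'_def
    using s(1)[of n] S by (intro borel_measurable_if_I borel_measurable_simple_function) auto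
  have "AE t in lebesgue. t \<in> S \<longrightarrow> (\<lambda>n. s n t) \<longlonglongrightarrow> f t"
    using s(2) S by (subst (asm) AE_restrict_space_iff) auto
  then have conv: "AE t in lebesgue. (\<lambda>n. s' n t) \<longlonglongrightarrow> (if t \<in> S then f t else 0)"
    by eventually_elim (auto simp: s'_def)
  then have "AE t in lebesgue. lim (\<lambda>n. s' n t) = (if t \<in> S then f t else 0)"
    by eventually_elim (rule limI)
  \<comment> \<open>\<open>lim\<close> is a total function and is measurable also across the points
    where the sequence diverges.\<close>
  moreover have "(\<lambda>t. lim (\<lambda>n. s' n t)) \<in> borel_measurable lebesgue"
    by (intro borel_measurable_lim_metric s'_meas)
  ultimately have "(\<lambda>t. if t \<in> S then f t else 0) \<in> borel_measurable lebesgue"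
    by (rule borel_measurable_AE[rotated])
  then show ?thesis using borel_measurable_if S by blast
qed

section \<open>Square integrable functions: domination and closure properties\<close>

lemma bochner_L2_imp_strongly_measurable:
  "f \<in> bochner_L2 T \<Longrightarrow> strongly_measurable (lebesgue_on {0<..<T}) f"
  by (simp add: bochner_L2_def)

lemma bochner_L2_imp_measurable:
  fixes f :: "real \<Rightarrow> 'b::euclidean_space"
  shows "f \<in> bochner_L2 T \<Longrightarrow> f \<in> borel_measurable (lebesgue_on {0<..<T})"
  by (rule strongly_measurable_imp_borel_measurable[OF bochner_L2_imp_strongly_measurable]) simp_all

lemma norm_L2_nonneg: "norm_L2 T f \<ge> 0"
  by (simp add: norm_L2_def)

lemma norm_L2_power2: "(norm_L2 T f)\<^sup>2 = (LINT t|lebesgue_on {0<..<T}. (norm (f t))\<^sup>2)"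
  by (simp add: norm_L2_def)

lemma strongly_measurable_norm_power2:
  fixes T :: real
  assumes "strongly_measurable (lebesgue_on {0<..<T}) f"
  shows "(\<lambda>t. (norm (f t))\<^sup>2) \<in> borel_measurable (lebesgue_on {0<..<T})"
proof (rule strongly_measurable_imp_borel_measurable)
  show "strongly_measurable (lebesgue_on {0<..<T}) (\<lambda>t. (norm (f t))\<^sup>2)"
    by (rule strongly_measurable_compose[OF assms]) (intro continuous_intros)
qed simp

lemma bochner_L2_dominated:
  assumes f: "strongly_measurable (lebesgue_on {0<..<T}) f" and g: "g \<in> bochner_L2 T"
    and le: "AE t in lebesgue_on {0<..<T}. norm (f t) \<le> c * norm (g t)"
  shows "f \<in> bochner_L2 T"
proof -
  have "integrable (lebesgue_on {0<..<T}) (\<lambda>t. c\<^sup>2 * (norm (g t))\<^sup>2)"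
    using g by (simp add: bochner_L2_def)
  then have "integrable (lebesgue_on {0<..<T}) (\<lambda>t. (norm (f t))\<^sup>2)"
  proof (rule Bochner_Integration.integrable_bound)
    show "AE t in lebesgue_on {0<..<T}. norm ((norm (f t))\<^sup>2) \<le> norm (c\<^sup>2 * (norm (g t))\<^sup>2)"
      using le by eventually_elim (auto simp flip: power_mult_distrib intro!: power_mono)
  qed (rule strongly_measurable_norm_power2[OF f])
  with f show ?thesis by (simp add: bochner_L2_def)
qed

text \<open>The quantitative estimates for all three partial derivatives are made pointwise and
  passed to the norm here. The dominating function is the perturbation for the coefficients,
  \<open>\<alpha>\<close> for the paths, and a sum of weighted operator norms for the modes.\<close>

lemma norm_L2_dominated:
  assumes f: "f \<in> bochner_L2 T" and g: "g \<in> bochner_L2 T" and "c \<ge> 0"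
    and le: "AE t in lebesgue_on {0<..<T}. norm (f t) \<le> c * norm (g t)"
  shows "norm_L2 T f \<le> c * norm_L2 T g"
proof (rule power2_le_imp_le)
  have "(norm_L2 T f)\<^sup>2 \<le> (LINT t|lebesgue_on {0<..<T}. c\<^sup>2 * (norm (g t))\<^sup>2)"
    unfolding norm_L2_power2
  proof (rule integral_mono_AE)
    show "integrable (lebesgue_on {0<..<T}) (\<lambda>t. (norm (f t))\<^sup>2)"
      using f by (simp add: bochner_L2_def)
    show "integrable (lebesgue_on {0<..<T}) (\<lambda>t. c\<^sup>2 * (norm (g t))\<^sup>2)"
      using g by (simp add: bochner_L2_def)
    show "AE t in lebesgue_on {0<..<T}. (norm (f t))\<^sup>2 \<le> c\<^sup>2 * (norm (g t))\<^sup>2"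
      using le by eventually_elim (auto simp flip: power_mult_distrib intro!: power_mono)
  qed
  also have "\<dots> = (c * norm_L2 T g)\<^sup>2"
    unfolding power_mult_distrib norm_L2_power2 by (rule integral_mult_right_zero)
  finally show "(norm_L2 T f)\<^sup>2 \<le> (c * norm_L2 T g)\<^sup>2" .
  show "0 \<le> c * norm_L2 T g" using \<open>c \<ge> 0\<close> by (intro mult_nonneg_nonneg norm_L2_nonneg)
qed

lemma bochner_L2_add:
  assumes "f \<in> bochner_L2 T" and "g \<in> bochner_L2 T"
  shows "(\<lambda>t. f t + g t) \<in> bochner_L2 T"
proof -
  have sm: "strongly_measurable (lebesgue_on {0<..<T}) (\<lambda>t. f t + g t)"
    using assms by (intro strongly_measurable_add bochner_L2_imp_strongly_measurable)
  have "(norm (a + b))\<^sup>2 \<le> 2 * (norm a)\<^sup>2 + 2 * (norm b)\<^sup>2" for a b :: 'a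
  proof -
    have "(norm (a + b))\<^sup>2 \<le> (norm a + norm b)\<^sup>2"
      by (intro power_mono norm_triangle_ineq) auto
    also have "\<dots> \<le> 2 * (norm a)\<^sup>2 + 2 * (norm b)\<^sup>2"
      using zero_le_power2[of "norm a - norm b"] by (simp add: power2_eq_square algebra_simps)
    finally show ?thesis .
  qed
  moreover have "integrable (lebesgue_on {0<..<T}) (\<lambda>t. 2 * (norm (f t))\<^sup>2 + 2 * (norm (g t))\<^sup>2)"
    using assms by (simp add: bochner_L2_def)
  ultimately have "integrable (lebesgue_on {0<..<T}) (\<lambda>t. (norm (f t + g t))\<^sup>2)"
    by (intro Bochner_Integration.integrable_bound[OF _ strongly_measurable_norm_power2[OF sm]])
       auto
  with sm show ?thesis by (simp add: bochner_L2_def)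
qed

lemma bochner_L2_bounded_linear:
  assumes "bounded_linear h" and f: "f \<in> bochner_L2 T"
  shows "(\<lambda>t. h (f t)) \<in> bochner_L2 T"
proof (rule bochner_L2_dominated[OF _ f])
  show "strongly_measurable (lebesgue_on {0<..<T}) (\<lambda>t. h (f t))"
    by (rule strongly_measurable_compose[OF bochner_L2_imp_strongly_measurable[OF f]
          linear_continuous_on[OF assms(1)]])
  show "AE t in lebesgue_on {0<..<T}. norm (h (f t)) \<le> onorm h * norm (f t)"
    using onorm[OF assms(1)] by simp
qed

lemma bochner_L2_scaleR: "f \<in> bochner_L2 T \<Longrightarrow> (\<lambda>t. c *\<^sub>R f t) \<in> bochner_L2 T"
  by (rule bochner_L2_bounded_linear[OF bounded_linear_scaleR_right])

lemma bochner_L2_diff: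
  "f \<in> bochner_L2 T \<Longrightarrow> g \<in> bochner_L2 T \<Longrightarrow> (\<lambda>t. f t - g t) \<in> bochner_L2 T"
  using bochner_L2_add[of f T "\<lambda>t. (- 1) *\<^sub>R g t"] bochner_L2_scaleR[of g T "- 1"] by simp

lemma bochner_L2_component: "f \<in> bochner_L2 T \<Longrightarrow> (\<lambda>t. f t $ i) \<in> bochner_L2 T"
  by (rule bochner_L2_bounded_linear[OF bounded_linear_vec_nth])

lemma bochner_L2_norm:
  assumes f: "f \<in> bochner_L2 T"
  shows "(\<lambda>t. norm (f t)) \<in> bochner_L2 T"
proof (rule bochner_L2_dominated[OF _ f])
  show "strongly_measurable (lebesgue_on {0<..<T}) (\<lambda>t. norm (f t))"
    by (rule strongly_measurable_compose[OF bochner_L2_imp_strongly_measurable[OF f]])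
       (intro continuous_intros)
  show "AE t in lebesgue_on {0<..<T}. norm (norm (f t)) \<le> 1 * norm (f t)" by simp
qed

lemma bochner_L2_sum:
  assumes "\<And>i. i \<in> I \<Longrightarrow> f i \<in> bochner_L2 T"
  shows "(\<lambda>t. \<Sum>i\<in>I. f i t) \<in> bochner_L2 T"
  using assms
proof (induction I rule: infinite_finite_induct)
  case (insert i I)
  then show ?case using bochner_L2_add[of "f i" T "\<lambda>t. \<Sum>i\<in>I. f i t"] by simp
qed (simp_all add: bochner_L2_def strongly_measurable_const)

section \<open>The inner product of square integrable functions and the Cauchy-Schwarz
  inequality\<close>

lemma integrable_inner_L2:
  assumes "f \<in> bochner_L2 T" and "g \<in> bochner_L2 T"
  shows "integrable (lebesgue_on {0<..<T}) (\<lambda>t. f t \<bullet> g t)"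
proof (rule Bochner_Integration.integrable_bound)
  show "integrable (lebesgue_on {0<..<T}) (\<lambda>t. (norm (f t))\<^sup>2 + (norm (g t))\<^sup>2)"
    using assms by (simp add: bochner_L2_def)
  show "(\<lambda>t. f t \<bullet> g t) \<in> borel_measurable (lebesgue_on {0<..<T})"
    by (rule strongly_measurable_imp_borel_measurable[OF strongly_measurable_inner])
       (simp_all add: assms bochner_L2_imp_strongly_measurable)
  have "\<bar>a \<bullet> b\<bar> \<le> (norm a)\<^sup>2 + (norm b)\<^sup>2" for a b :: 'a
  proof -
    have "0 \<le> (norm a - norm b)\<^sup>2" "0 \<le> norm a * norm b" by auto
    then have "norm a * norm b \<le> (norm a)\<^sup>2 + (norm b)\<^sup>2" unfolding power2_diff by linarith
    then show ?thesis using Cauchy_Schwarz_ineq2[of a b] by linarith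
  qed
  then show "AE t in lebesgue_on {0<..<T}.
      norm (f t \<bullet> g t) \<le> norm ((norm (f t))\<^sup>2 + (norm (g t))\<^sup>2)" by simp
qed

lemma inner_L2_add_right:
  assumes "f \<in> bochner_L2 T" and "g \<in> bochner_L2 T" and "h \<in> bochner_L2 T"
  shows "inner_L2 T f (\<lambda>t. g t + h t) = inner_L2 T f g + inner_L2 T f h"
  using assms by (simp add: inner_L2_def inner_add_right integrable_inner_L2)

lemma inner_L2_diff_right:
  assumes "f \<in> bochner_L2 T" and "g \<in> bochner_L2 T" and "h \<in> bochner_L2 T"
  shows "inner_L2 T f (\<lambda>t. g t - h t) = inner_L2 T f g - inner_L2 T f h"
  using assms by (simp add: inner_L2_def inner_diff_right integrable_inner_L2)

lemma inner_L2_scaleR_right: "inner_L2 T f (\<lambda>t. c *\<^sub>R g t) = c * inner_L2 T f g"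
  by (simp add: inner_L2_def)

lemma inner_L2_sum_right:
  assumes "f \<in> bochner_L2 T" and "\<And>i. i \<in> I \<Longrightarrow> g i \<in> bochner_L2 T"
  shows "inner_L2 T f (\<lambda>t. \<Sum>i\<in>I. g i t) = (\<Sum>i\<in>I. inner_L2 T f (g i))"
  using assms by (simp add: inner_L2_def inner_sum_right integrable_inner_L2)

lemma norm_L2_add_power2:
  assumes f: "f \<in> bochner_L2 T" and g: "g \<in> bochner_L2 T"
  shows "(norm_L2 T (\<lambda>t. f t + g t))\<^sup>2
    = (norm_L2 T f)\<^sup>2 + 2 * inner_L2 T f g + (norm_L2 T g)\<^sup>2"
proof -
  have "(norm_L2 T (\<lambda>t. f t + g t))\<^sup>2
      = (LINT t|lebesgue_on {0<..<T}. (norm (f t))\<^sup>2 + 2 * (f t \<bullet> g t) + (norm (g t))\<^sup>2)"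
    unfolding norm_L2_power2
    by (intro Bochner_Integration.integral_cong)
       (auto simp: power2_norm_eq_inner inner_add_left inner_add_right inner_commute)
  then show ?thesis
    using f g integrable_inner_L2[OF f g]
    by (simp add: norm_L2_power2 inner_L2_def bochner_L2_def)
qed

lemma Cauchy_Schwarz_L2:
  assumes f: "f \<in> bochner_L2 T" and g: "g \<in> bochner_L2 T"
  shows "\<bar>inner_L2 T f g\<bar> \<le> norm_L2 T f * norm_L2 T g"
proof -
  define a b c where "a = (norm_L2 T f)\<^sup>2" and "b = inner_L2 T f g" and "c = (norm_L2 T g)\<^sup>2"
  have q: "0 \<le> a + 2 * (s * b) + s\<^sup>2 * c" for s
  proof -
    have "(norm_L2 T (\<lambda>t. s *\<^sub>R g t))\<^sup>2 = s\<^sup>2 * c"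
      by (simp add: norm_L2_power2 c_def power_mult_distrib)
    then have "a + 2 * (s * b) + s\<^sup>2 * c = (norm_L2 T (\<lambda>t. f t + s *\<^sub>R g t))\<^sup>2"
      by (simp add: norm_L2_add_power2[OF f bochner_L2_scaleR[OF g]] inner_L2_scaleR_right
          a_def b_def)
    then show ?thesis by simp
  qed
  \<comment> \<open>For \<open>c > 0\<close> the minimizer \<open>- b / c\<close> of the quadratic
    is inserted. For \<open>c = 0\<close>, which can happen for a nonzero representative
    \<open>g\<close>, the polynomial is affine in \<open>s\<close>, and a nonzero \<open>b\<close>
    would give it the value -1 at \<open>- (a + 1) / (2 * b)\<close>.\<close>
  have "b\<^sup>2 \<le> a * c"
  proof (cases "c = 0")
    case True
    have "b = 0"
    proof (rule ccontr)
      assume "b \<noteq> 0"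
      then have "2 * (- (a + 1) / (2 * b) * b) = - (a + 1)" by simp
      then show False using q[of "- (a + 1) / (2 * b)"] True by (simp add: a_def)
    qed
    then show ?thesis using True by simp
  next
    case False
    then have "c > 0" by (simp add: c_def)
    then show ?thesis using q[of "- b / c"]
      by (simp add: field_simps power2_eq_square)
  qed
  then have "\<bar>b\<bar>\<^sup>2 \<le> (norm_L2 T f * norm_L2 T g)\<^sup>2"
    by (simp add: a_def c_def power_mult_distrib)
  then show ?thesis
    unfolding b_def by (rule power2_le_imp_le) (simp add: norm_L2_nonneg)
qed

lemma norm_L2_triangle:
  fixes f g :: "real \<Rightarrow> 'a::real_inner"
  assumes f: "f \<in> bochner_L2 T" and g: "g \<in> bochner_L2 T"
  shows "norm_L2 T (\<lambda>t. f t + g t) \<le> norm_L2 T f + norm_L2 T g"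
proof (rule power2_le_imp_le)
  show "(norm_L2 T (\<lambda>t. f t + g t))\<^sup>2 \<le> (norm_L2 T f + norm_L2 T g)\<^sup>2"
    using Cauchy_Schwarz_L2[OF f g]
    by (simp add: norm_L2_add_power2[OF f g] power2_sum abs_le_iff)
qed (simp add: norm_L2_nonneg)

section \<open>First-order expansion of half the squared norm\<close>

lemma half_norm_L2_power2_remainder:
  assumes w: "w \<in> bochner_L2 T" and d: "d \<in> bochner_L2 T" and l: "l \<in> bochner_L2 T"
  shows "\<bar>1/2 * (norm_L2 T (\<lambda>t. w t + d t))\<^sup>2 - 1/2 * (norm_L2 T w)\<^sup>2 - inner_L2 T w l\<bar>
    \<le> norm_L2 T w * norm_L2 T (\<lambda>t. d t - l t) + (norm_L2 T d)\<^sup>2 / 2"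
proof -
  have "1/2 * (norm_L2 T (\<lambda>t. w t + d t))\<^sup>2 - 1/2 * (norm_L2 T w)\<^sup>2 - inner_L2 T w l
      = inner_L2 T w (\<lambda>t. d t - l t) + (norm_L2 T d)\<^sup>2 / 2"
    unfolding norm_L2_add_power2[OF w d] inner_L2_diff_right[OF w d l]
    by (simp add: add_divide_distrib)
  then show ?thesis
    using Cauchy_Schwarz_L2[OF w bochner_L2_diff[OF d l]]
    by (simp add: abs_le_iff) (smt (verit) zero_le_power2)
qed

text \<open>The remainder has a part linear in \<open>\<Delta> u - L u\<close>, which is little-o,
  and a part quadratic in \<open>\<Delta> u\<close>, which is of order \<open>(N u)\<^sup>2\<close>
  because \<open>\<Delta> u\<close> differs from the bounded \<open>L u\<close> by little-o. The set
  \<open>V\<close> and the function \<open>N\<close> are left general so that both the spaces of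
  representatives with a seminorm and the normed space of modes are covered.\<close>

lemma half_norm_L2_power2_frechet:
  assumes w: "w \<in> bochner_L2 T"
    and \<Delta>: "\<And>u. u \<in> V \<Longrightarrow> \<Delta> u \<in> bochner_L2 T" and L: "\<And>u. u \<in> V \<Longrightarrow> L u \<in> bochner_L2 T"
    and N: "\<And>u. u \<in> V \<Longrightarrow> N u \<ge> 0"
    and bound: "\<And>u. u \<in> V \<Longrightarrow> norm_L2 T (L u) \<le> K * N u"
    and little_o: "\<And>\<epsilon>. \<epsilon> > 0 \<Longrightarrow>
      \<exists>\<delta>>0. \<forall>u\<in>V. N u < \<delta> \<longrightarrow> norm_L2 T (\<lambda>t. \<Delta> u t - L u t) \<le> \<epsilon> * N u"
    and "\<epsilon> > (0::real)"
  shows "\<exists>\<delta>>0. \<forall>u\<in>V. N u < \<delta> \<longrightarrow>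
    \<bar>1/2 * (norm_L2 T (\<lambda>t. w t + \<Delta> u t))\<^sup>2 - 1/2 * (norm_L2 T w)\<^sup>2 - inner_L2 T w (L u)\<bar>
      \<le> \<epsilon> * N u"
proof -
  \<comment> \<open>The summand 1 permits division by \<open>W\<close> when the residual vanishes.
    In \<open>C\<close> below, the absolute value covers a negative \<open>K\<close> and the summand
    1 absorbs the remainder \<open>\<Delta> u - L u\<close>, which is at most \<open>N u\<close>
    within the radius \<open>\<delta>2\<close>.\<close>
  define W where "W = norm_L2 T w + 1"
  have W: "W > 0" "norm_L2 T w \<le> W" using norm_L2_nonneg[of T w] by (auto simp: W_def)
  define C where "C = \<bar>K\<bar> + 1"
  have C: "C > 0" by (simp add: C_def add_nonneg_pos)
  obtain \<delta>1 where \<delta>1: "\<delta>1 > 0" 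
      "\<And>u. u \<in> V \<Longrightarrow> N u < \<delta>1 \<Longrightarrow> norm_L2 T (\<lambda>t. \<Delta> u t - L u t) \<le> \<epsilon> / (2 * W) * N u"
    using little_o[of "\<epsilon> / (2 * W)"] W \<open>\<epsilon> > 0\<close> by auto
  obtain \<delta>2 where \<delta>2: "\<delta>2 > 0" 
      "\<And>u. u \<in> V \<Longrightarrow> N u < \<delta>2 \<Longrightarrow> norm_L2 T (\<lambda>t. \<Delta> u t - L u t) \<le> 1 * N u"
    using little_o[of 1] by auto
  \<comment> \<open>The last bound gives \<open>C\<^sup>2 * N u \<le> \<epsilon>\<close>, so that
    the quadratic part costs at most half of \<open>\<epsilon> * N u\<close>; the other half is
    spent on the part linear in the residual.\<close>
  define \<delta> where "\<delta> = min (min \<delta>1 \<delta>2) (\<epsilon> / C\<^sup>2)"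
  have "\<delta> > 0" using \<delta>1 \<delta>2 C \<open>\<epsilon> > 0\<close> by (simp add: \<delta>_def)
  moreover have "\<bar>1/2 * (norm_L2 T (\<lambda>t. w t + \<Delta> u t))\<^sup>2 - 1/2 * (norm_L2 T w)\<^sup>2
      - inner_L2 T w (L u)\<bar> \<le> \<epsilon> * N u" if u: "u \<in> V" "N u < \<delta>" for u
  proof -
    have "norm_L2 T w * norm_L2 T (\<lambda>t. \<Delta> u t - L u t) \<le> W * (\<epsilon> / (2 * W) * N u)"
      using u W \<delta>1(2)[of u] by (intro mult_mono) (auto simp: \<delta>_def norm_L2_nonneg)
    then have 1: "norm_L2 T w * norm_L2 T (\<lambda>t. \<Delta> u t - L u t) \<le> \<epsilon> / 2 * N u"
      using W by simp
    have "norm_L2 T (\<Delta> u) = norm_L2 T (\<lambda>t. L u t + (\<Delta> u t - L u t))" by simp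
    also have "\<dots> \<le> norm_L2 T (L u) + norm_L2 T (\<lambda>t. \<Delta> u t - L u t)"
      by (intro norm_L2_triangle bochner_L2_diff \<Delta> L u)
    also have "\<dots> \<le> K * N u + N u"
      using bound[of u] \<delta>2(2)[of u] u by (auto simp: \<delta>_def intro!: add_mono)
    also have "\<dots> \<le> C * N u"
      using N[OF u(1)] mult_right_mono[of K "\<bar>K\<bar>" "N u"] by (simp add: C_def algebra_simps)
    finally have "(norm_L2 T (\<Delta> u))\<^sup>2 \<le> (C * N u)\<^sup>2"
      by (intro power_mono) (auto simp: norm_L2_nonneg)
    also have "\<dots> = (C\<^sup>2 * N u) * N u" by (simp add: power2_eq_square)
    also have "\<dots> \<le> \<epsilon> * N u"
      using u C N[OF u(1)] by (intro mult_right_mono) (auto simp: \<delta>_def field_simps)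
    finally have 2: "(norm_L2 T (\<Delta> u))\<^sup>2 / 2 \<le> \<epsilon> / 2 * N u" by simp
    show ?thesis
      using half_norm_L2_power2_remainder[OF w \<Delta>[OF u(1)] L[OF u(1)]] 1 2 by simp
  qed
  ultimately show ?thesis by blast
qed

section \<open>Integrals over a bounded interval against bounded and continuous weights\<close>

lemma bochner_L2_const: "(\<lambda>t. c) \<in> bochner_L2 T"
proof -
  have "finite_measure (lebesgue_on {0<..<T})" by (rule finite_measure_lebesgue_on) simp
  then show ?thesis
    by (simp add: bochner_L2_def strongly_measurable_const finite_measure.integrable_const)
qed

lemma bochner_L2_imp_integrable:
  fixes f :: "real \<Rightarrow> 'b::euclidean_space"
  assumes "f \<in> bochner_L2 T"
  shows "integrable (lebesgue_on {0<..<T}) f"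
proof -
  have "integrable (lebesgue_on {0<..<T}) (\<lambda>t. norm (f t))"
    using integrable_inner_L2[OF bochner_L2_const[of "1::real"] bochner_L2_norm[OF assms]] by simp
  then show ?thesis using bochner_L2_imp_measurable[OF assms] integrable_norm_iff by blast
qed

text \<open>Cauchy-Schwarz against the constant function 1. The factor is the square root of
  \<open>T\<close> for positive \<open>T\<close>, left unevaluated.\<close>

lemma integral_norm_le_norm_L2:
  assumes "f \<in> bochner_L2 T"
  shows "(LINT t|lebesgue_on {0<..<T}. norm (f t)) \<le> norm_L2 T (\<lambda>t. 1::real) * norm_L2 T f"
  using Cauchy_Schwarz_L2[OF bochner_L2_const[of "1::real"] bochner_L2_norm[OF assms]]
  by (simp add: inner_L2_def norm_L2_def)

lemma continuous_imp_measurable_lebesgue_on: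
  fixes g :: "real \<Rightarrow> real"
  assumes "continuous_on UNIV g"
  shows "g \<in> borel_measurable (lebesgue_on S)"
  using borel_measurable_continuous_onI[OF assms]
  by (simp add: measurable_completion measurable_restrict_space1)

lemma integrable_scaleR_bounded:
  fixes u :: "real \<Rightarrow> 'b::euclidean_space"
  assumes g: "g \<in> borel_measurable (lebesgue_on {0<..<T})"
    and bound: "\<And>t. t \<in> {0<..<T} \<Longrightarrow> \<bar>g t\<bar> \<le> B"
    and u: "integrable (lebesgue_on {0<..<T}) u"
  shows "integrable (lebesgue_on {0<..<T}) (\<lambda>t. g t *\<^sub>R u t)"
    and "norm (LINT t|lebesgue_on {0<..<T}. g t *\<^sub>R u t)
      \<le> B * (LINT t|lebesgue_on {0<..<T}. norm (u t))"
proof -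
  have le: "norm (g t *\<^sub>R u t) \<le> B * norm (u t)" if "t \<in> {0<..<T}" for t
    using bound[OF that] by (simp add: mult_right_mono)
  have int: "integrable (lebesgue_on {0<..<T}) (\<lambda>t. B * norm (u t))"
    using u by simp
  have "u \<in> borel_measurable (lebesgue_on {0<..<T})" using u by auto
  with g have "(\<lambda>t. g t *\<^sub>R u t) \<in> borel_measurable (lebesgue_on {0<..<T})"
    by (rule borel_measurable_scaleR)
  then show int': "integrable (lebesgue_on {0<..<T}) (\<lambda>t. g t *\<^sub>R u t)"
  proof (rule Bochner_Integration.integrable_bound[OF int])
    have "norm (g t *\<^sub>R u t) \<le> norm (B * norm (u t))" if "t \<in> {0<..<T}" for t
      using le[OF that] abs_ge_self[of "B * norm (u t)"] unfolding real_norm_def by linarith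
    then show "AE t in lebesgue_on {0<..<T}. norm (g t *\<^sub>R u t) \<le> norm (B * norm (u t))"
      by (intro AE_I2) simp
  qed
  have "norm (LINT t|lebesgue_on {0<..<T}. g t *\<^sub>R u t)
      \<le> (LINT t|lebesgue_on {0<..<T}. B * norm (u t))"
    by (rule Bochner_Integration.integral_norm_bound_integral[OF int' int]) (use le in simp)
  then show "norm (LINT t|lebesgue_on {0<..<T}. g t *\<^sub>R u t)
      \<le> B * (LINT t|lebesgue_on {0<..<T}. norm (u t))" by simp
qed

lemma continuous_bounded_on_interval:
  fixes g :: "real \<Rightarrow> real"
  assumes "continuous_on UNIV g"
  obtains B where "\<And>t. t \<in> {0<..<T} \<Longrightarrow> \<bar>g t\<bar> \<le> B"
proof -
  have "bounded (g ` {0..T})"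
    by (intro compact_imp_bounded compact_continuous_image continuous_on_subset[OF assms]) auto
  then obtain B where "\<forall>x\<in>g ` {0..T}. norm x \<le> B" unfolding bounded_iff by blast
  then show thesis by (intro that[of B]) auto
qed

lemma integrable_scaleR_continuous:
  fixes u :: "real \<Rightarrow> 'b::euclidean_space"
  assumes "continuous_on UNIV g" and "integrable (lebesgue_on {0<..<T}) u"
  shows "integrable (lebesgue_on {0<..<T}) (\<lambda>t. g t *\<^sub>R u t)"
proof -
  obtain B where "\<And>t. t \<in> {0<..<T} \<Longrightarrow> \<bar>g t\<bar> \<le> B"
    using continuous_bounded_on_interval[OF assms(1)] by metis
  then show ?thesis
    using integrable_scaleR_bounded(1) continuous_imp_measurable_lebesgue_on[OF assms(1)] assms(2)
    by metis
qed

lemma continuous_imp_integrable_lebesgue_on: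
  fixes g :: "real \<Rightarrow> real"
  assumes "continuous_on UNIV g"
  shows "integrable (lebesgue_on {0<..<T}) g"
  using integrable_scaleR_continuous[OF assms bochner_L2_imp_integrable[OF bochner_L2_const[of "1::real" T]]]
  by simp

section \<open>The Sobolev space on an interval\<close>

text \<open>A primitive vanishing to the left of the support of \<open>\<rho>\<close> vanishes to
  its right exactly because \<open>\<rho>\<close> has mean zero, so it has compact support. The
  bound of its supremum by the \<open>L\<^sup>1\<close> norm of \<open>\<rho>\<close> is the source
  of the \<open>L\<^sup>1\<close> norm in the pairing estimate.\<close>

lemma test_function_primitive:
  fixes \<rho> :: "real \<Rightarrow> real"
  assumes cont: "continuous_on UNIV \<rho>" and ab: "0 < a" "a \<le> b" "b < T"
    and supp: "\<And>t. t \<notin> {a<..<b} \<Longrightarrow> \<rho> t = 0"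
    and mean: "(LINT t|lebesgue_on {0<..<T}. \<rho> t) = 0"
  obtains \<psi> where "test_function T \<psi>" and "deriv \<psi> = \<rho>" and "continuous_on UNIV \<psi>"
    and "\<And>t. \<bar>\<psi> t\<bar> \<le> (LINT t|lebesgue_on {0<..<T}. \<bar>\<rho> t\<bar>)"
proof -
  have "\<exists>F. \<forall>x::real. -\<infinity> < ereal x \<longrightarrow> ereal x < \<infinity> \<longrightarrow> (F has_vector_derivative \<rho> x) (at x)"
    using cont by (intro einterval_antiderivative) (auto simp: continuous_on_eq_continuous_at)
  then obtain F where F: "\<And>x. (F has_vector_derivative \<rho> x) (at x)" by auto
  have FTC: "(\<rho> has_integral F t - F s) {s..t}" if "s \<le> t" for s t
    using that F by (intro fundamental_theorem_of_calculus) (auto intro: has_vector_derivative_at_within)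
  have zero: "F t = F s" if "s \<le> t" "\<And>x. x \<in> {s..t} \<Longrightarrow> \<rho> x = 0" for s t
    using has_integral_unique[OF FTC[OF that(1)] has_integral_is_0[of "{s..t}" \<rho>]] that(2) by auto
  have LINT: "(LINT t|lebesgue_on {0<..<T}. h t) = integral {0..T} h" if "continuous_on UNIV h"
    for h :: "real \<Rightarrow> real"
    using lebesgue_integral_eq_integral[OF continuous_imp_integrable_lebesgue_on[OF that, of T]]
    by (simp add: integral_open_interval_real)
  have abs: "continuous_on UNIV (\<lambda>t. \<bar>\<rho> t\<bar>)" by (intro continuous_intros cont)
  \<comment> \<open>Since \<open>t\<close> can lie on either side of 0, the point
    \<open>min t 0\<close> serves as a common left end; the intervals from it to \<open>a\<close>,
    \<open>t\<close> and 0 all avoid the interior of the support.\<close>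
  have left: "F t = F 0" if "t \<le> a" for t
  proof -
    have "F (min t 0) = F a" "F (min t 0) = F t" "F (min t 0) = F 0"
      using that ab supp
      by ((intro zero[symmetric]; force), (intro zero[symmetric]; force), (intro zero[symmetric]; force))
    then show ?thesis by simp
  qed
  have "F T - F 0 = 0"
    using FTC[of 0 T] ab mean LINT[OF cont] by (auto simp: integral_unique)
  moreover have "F t = F b" if "t \<ge> b" for t
    by (rule zero[OF that]) (rule supp, simp)
  ultimately have right: "F t = F 0" if "t \<ge> b" for t
    using that ab by (metis eq_iff_diff_eq_0 less_imp_le)
  define \<psi> where "\<psi> t = F t - F 0" for t
  have \<psi>': "(\<psi> has_vector_derivative \<rho> t) (at t)" for t
    unfolding \<psi>_def using F[of t] by (auto intro!: derivative_eq_intros)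
  then have "\<psi> C1_differentiable_on UNIV" unfolding C1_differentiable_on_def using cont by blast
  moreover have "\<psi> t = 0" if "t \<notin> {a..b}" for t
    using that left[of t] right[of t] by (auto simp: \<psi>_def)
  ultimately have 1: "test_function T \<psi>" unfolding test_function_def using ab by blast
  have 2: "deriv \<psi> = \<rho>"
    using \<psi>' by (auto intro!: DERIV_imp_deriv simp: has_real_derivative_iff_has_vector_derivative)
  have 3: "continuous_on UNIV \<psi>"
    using \<psi>' by (meson continuous_on_vector_derivative has_vector_derivative_at_within)
  \<comment> \<open>Only points of \<open>{a..b}\<close>, hence of \<open>{0..T}\<close>, need an
    estimate; there \<open>\<psi> t\<close> is the integral of \<open>\<rho>\<close> from 0 to
    \<open>t\<close>.\<close>
  have 4: "\<bar>\<psi> t\<bar> \<le> (LINT t|lebesgue_on {0<..<T}. \<bar>\<rho> t\<bar>)" for t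
  proof (cases "t \<in> {a..b}")
    case True
    then have t: "0 \<le> t" "t \<le> T" using ab by auto
    have int: "\<rho> integrable_on {c..d}" "(\<lambda>x. \<bar>\<rho> x\<bar>) integrable_on {c..d}" for c d
      using cont abs by (auto intro: integrable_continuous_interval continuous_on_subset)
    have "\<psi> t = integral {0..t} \<rho>" using FTC[OF t(1)] by (simp add: \<psi>_def integral_unique)
    then have "\<bar>\<psi> t\<bar> \<le> integral {0..t} (\<lambda>x. \<bar>\<rho> x\<bar>)"
      using integral_norm_bound_integral[OF int(1) int(2), of 0 t] by simp
    also have "\<dots> \<le> integral {0..T} (\<lambda>x. \<bar>\<rho> x\<bar>)"
      using t by (intro integral_subset_le int) auto
    finally show ?thesis by (simp add: LINT[OF abs])
  next
    case False
    then have "\<psi> t = 0" using left[of t] right[of t] by (auto simp: \<psi>_def)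
    then show ?thesis by simp
  qed
  show thesis by (rule that[OF 1 2 3 4])
qed

text \<open>Subtracting a multiple of a fixed bump \<open>\<sigma>\<close> gives \<open>\<rho>\<close> mean zero. Its primitive \<open>\<psi>\<close> is then a test
  function, so the pairing of \<open>u\<close> with \<open>\<psi>'\<close> is controlled by the weak derivative.\<close>

lemma weak_derivative_pairing_bound:
  assumes "T > 0"
  obtains C where "C \<ge> 0"
    and "\<And>(u :: real \<Rightarrow> 'a::euclidean_space) v (\<rho> :: real \<Rightarrow> real) a b. \<lbrakk>u \<in> bochner_L2 T; v \<in> bochner_L2 T;
      has_weak_derivative T u v; continuous_on UNIV \<rho>; 0 < a; a \<le> b; b < T;
      \<And>t. t \<notin> {a<..<b} \<Longrightarrow> \<rho> t = 0\<rbrakk> \<Longrightarrow>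
      norm (LINT t|lebesgue_on {0<..<T}. \<rho> t *\<^sub>R u t)
        \<le> C * (norm_L2 T u + norm_L2 T v) * (LINT t|lebesgue_on {0<..<T}. \<bar>\<rho> t\<bar>)"
proof -
  let ?M = "lebesgue_on {0<..<T}"
  \<comment> \<open>A tent of height \<open>T/4\<close> centred at \<open>T/2\<close>. Its support
    keeps the distance \<open>T/4\<close> from both ends of the interval.\<close>
  define \<sigma> :: "real \<Rightarrow> real" where "\<sigma> t = max 0 (T/4 - \<bar>t - T/2\<bar>)" for t
  define c where "c = (LINT t|?M. \<sigma> t)"
  define k where "k = norm_L2 T (\<lambda>t. 1::real)"
  have \<sigma>_cont: "continuous_on UNIV \<sigma>" unfolding \<sigma>_def by (intro continuous_intros)
  have \<sigma>_nonneg: "0 \<le> \<sigma> t" for t by (simp add: \<sigma>_def)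
  have \<sigma>_le: "\<bar>\<sigma> t\<bar> \<le> T / 4" for t using assms by (auto simp: \<sigma>_def max_def abs_if)
  have \<sigma>_supp: "\<sigma> t = 0" if "t \<notin> {T/4<..<3*T/4}" for t
    using that by (auto simp: \<sigma>_def max_def abs_if split: if_splits)
  have c_eq: "c = integral {0..T} \<sigma>"
    using lebesgue_integral_eq_integral[OF continuous_imp_integrable_lebesgue_on[OF \<sigma>_cont, of T]]
    by (simp add: c_def integral_open_interval_real)
  \<comment> \<open>A continuous nonnegative function with zero integral vanishes, whereas the tent
    is positive at the midpoint.\<close>
  have "c \<noteq> 0"
  proof
    assume "c = 0"
    have "(\<sigma> has_integral 0) (cbox 0 T)"
      using \<open>c = 0\<close> c_eq continuous_on_subset[OF \<sigma>_cont, of "{0..T}"]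
      by (metis cbox_interval integrable_continuous_interval integrable_integral subset_UNIV)
    then have "\<sigma> (T/2) = 0"
      using assms \<sigma>_nonneg continuous_on_subset[OF \<sigma>_cont]
      by (intro has_integral_0_cbox_imp_0[of 0 T \<sigma>]) auto
    then show False using assms by (simp add: \<sigma>_def)
  qed
  moreover have "c \<ge> 0" unfolding c_def by (simp add: \<sigma>_nonneg)
  ultimately have c: "c > 0" by simp
  have k: "k \<ge> 0" by (simp add: k_def norm_L2_nonneg)
  \<comment> \<open>The first summand is the cost of the correction by the tent and goes with the
    norm of \<open>u\<close>; the second is the cost of the primitive and goes with the norm of
    \<open>v\<close>. The sum serves as a common factor of both norms.\<close>
  define C where "C = T / (4 * c) * k + 2 * k"
  show thesis
  proof (rule that)
    show "C \<ge> 0" using assms c k by (simp add: C_def)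
  next
    fix u v :: "real \<Rightarrow> 'a" and \<rho> :: "real \<Rightarrow> real" and a b
    assume u: "u \<in> bochner_L2 T" and v: "v \<in> bochner_L2 T" and weak: "has_weak_derivative T u v"
      and \<rho>: "continuous_on UNIV \<rho>" "0 < a" "a \<le> b" "b < T" "\<And>t. t \<notin> {a<..<b} \<Longrightarrow> \<rho> t = 0"
    define I where "I = (LINT t|?M. \<rho> t)"
    define R where "R = (LINT t|?M. \<bar>\<rho> t\<bar>)"
    have IR: "\<bar>I\<bar> \<le> R" unfolding I_def R_def by (rule integral_abs_bound)
    then have R: "R \<ge> 0" by simp
    define f where "f t = \<rho> t - I / c * \<sigma> t" for t
    have f_cont: "continuous_on UNIV f" unfolding f_def by (intro continuous_intros \<rho> \<sigma>_cont)
    note int\<rho> = continuous_imp_integrable_lebesgue_on[OF \<rho>(1), of T]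
      and int\<sigma> = continuous_imp_integrable_lebesgue_on[OF \<sigma>_cont, of T]
    have "(LINT t|?M. f t) = I - I / c * c"
      unfolding f_def c_def I_def using int\<rho> int\<sigma> by simp
    then have f_mean: "(LINT t|?M. f t) = 0" using c by simp
    have f_supp: "f t = 0" if "t \<notin> {min a (T/4)<..<max b (3*T/4)}" for t
    proof -
      have "t \<notin> {a<..<b}" "t \<notin> {T/4<..<3*T/4}" using that by auto
      then show ?thesis using \<rho>(5)[of t] \<sigma>_supp[of t] by (simp add: f_def)
    qed
    obtain \<psi> where \<psi>: "test_function T \<psi>" "deriv \<psi> = f" "continuous_on UNIV \<psi>"
        "\<And>t. \<bar>\<psi> t\<bar> \<le> (LINT t|?M. \<bar>f t\<bar>)"
      by (rule test_function_primitive[OF f_cont _ _ _ f_supp f_mean]) (use \<rho> assms in auto)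
    \<comment> \<open>The correction has \<open>L\<^sup>1\<close> norm \<open>\<bar>I\<bar>\<close>,
      because \<open>c\<close> is the integral of the tent, and this is at most \<open>R\<close>.
      Hence the factor 2 in \<open>C\<close>.\<close>
    have "(LINT t|?M. \<bar>f t\<bar>) \<le> (LINT t|?M. \<bar>\<rho> t\<bar> + \<bar>I\<bar> / c * \<sigma> t)"
    proof (rule integral_mono)
      show "integrable ?M (\<lambda>t. \<bar>f t\<bar>)"
        using continuous_imp_integrable_lebesgue_on[OF f_cont] by simp
      show "integrable ?M (\<lambda>t. \<bar>\<rho> t\<bar> + \<bar>I\<bar> / c * \<sigma> t)" using int\<rho> int\<sigma> by simp
      show "\<bar>f t\<bar> \<le> \<bar>\<rho> t\<bar> + \<bar>I\<bar> / c * \<sigma> t" for t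
        using c \<sigma>_nonneg[of t] abs_triangle_ineq4[of "\<rho> t" "I / c * \<sigma> t"]
        by (simp add: f_def abs_mult)
    qed
    also have "\<dots> = R + \<bar>I\<bar>" using c int\<rho> int\<sigma> by (simp add: R_def flip: c_def)
    finally have f_L1: "(LINT t|?M. \<bar>f t\<bar>) \<le> 2 * R" using IR by simp
    have u_int: "integrable ?M u" and v_int: "integrable ?M v"
      using u v by (auto intro: bochner_L2_imp_integrable)
    have "(LINT t|?M. f t *\<^sub>R u t) = - (LINT t|?M. \<psi> t *\<^sub>R v t)"
      using weak \<psi>(1,2) unfolding has_weak_derivative_def by blast
    moreover have "f t *\<^sub>R u t = \<rho> t *\<^sub>R u t - (I / c) *\<^sub>R (\<sigma> t *\<^sub>R u t)" for t
      by (simp add: f_def scaleR_diff_left)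
    then have "(LINT t|?M. f t *\<^sub>R u t)
        = (LINT t|?M. \<rho> t *\<^sub>R u t) - (I / c) *\<^sub>R (LINT t|?M. \<sigma> t *\<^sub>R u t)"
      using integrable_scaleR_continuous[OF \<rho>(1) u_int]
        integrable_scaleR_continuous[OF \<sigma>_cont u_int]
      by (simp del: scaleR_scaleR)
    ultimately have "(LINT t|?M. \<rho> t *\<^sub>R u t)
        = (I / c) *\<^sub>R (LINT t|?M. \<sigma> t *\<^sub>R u t) - (LINT t|?M. \<psi> t *\<^sub>R v t)"
      by (simp add: algebra_simps)
    then have "norm (LINT t|?M. \<rho> t *\<^sub>R u t)
        \<le> \<bar>I\<bar> / c * norm (LINT t|?M. \<sigma> t *\<^sub>R u t) + norm (LINT t|?M. \<psi> t *\<^sub>R v t)"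
      using norm_triangle_ineq4 c by (metis abs_divide abs_of_pos norm_scaleR)
    also have "\<dots> \<le> R / c * (T / 4 * (k * norm_L2 T u)) + 2 * R * (k * norm_L2 T v)"
    proof (intro add_mono mult_mono)
      show "\<bar>I\<bar> / c \<le> R / c" using IR c by (simp add: divide_right_mono)
      have "norm (LINT t|?M. \<sigma> t *\<^sub>R u t) \<le> T / 4 * (LINT t|?M. norm (u t))"
        by (rule integrable_scaleR_bounded(2)[OF _ _ u_int])
           (rule continuous_imp_measurable_lebesgue_on[OF \<sigma>_cont], rule \<sigma>_le)
      also have "\<dots> \<le> T / 4 * (k * norm_L2 T u)"
        using integral_norm_le_norm_L2[OF u] assms by (simp add: k_def)
      finally show "norm (LINT t|?M. \<sigma> t *\<^sub>R u t) \<le> T / 4 * (k * norm_L2 T u)" .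
      have "norm (LINT t|?M. \<psi> t *\<^sub>R v t) \<le> 2 * R * (LINT t|?M. norm (v t))"
        by (rule integrable_scaleR_bounded(2)[OF _ _ v_int])
           (use order_trans[OF \<psi>(4) f_L1] continuous_imp_measurable_lebesgue_on[OF \<psi>(3)] in auto)
      also have "\<dots> \<le> 2 * R * (k * norm_L2 T v)"
        using integral_norm_le_norm_L2[OF v] R by (intro mult_left_mono) (simp_all add: k_def)
      finally show "norm (LINT t|?M. \<psi> t *\<^sub>R v t) \<le> 2 * R * (k * norm_L2 T v)" .
    qed (use R c in auto)
    also have "\<dots> = (T / (4 * c) * k * norm_L2 T u + 2 * k * norm_L2 T v) * R"
      by (simp add: algebra_simps)
    also have "\<dots> \<le> C * (norm_L2 T u + norm_L2 T v) * R"
    proof (rule mult_right_mono[OF _ R])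
      have "0 \<le> T / (4 * c) * k * norm_L2 T v" "0 \<le> 2 * k * norm_L2 T u"
        using assms c k by (auto simp: norm_L2_nonneg)
      then show "T / (4 * c) * k * norm_L2 T u + 2 * k * norm_L2 T v
          \<le> C * (norm_L2 T u + norm_L2 T v)"
        unfolding C_def distrib_left distrib_right by linarith
    qed
    finally show "norm (LINT t|?M. \<rho> t *\<^sub>R u t)
        \<le> C * (norm_L2 T u + norm_L2 T v) * (LINT t|?M. \<bar>\<rho> t\<bar>)" by (simp add: R_def)
  qed
qed

text \<open>The bound is available only for continuous functions supported inside (0,T), so the
  indicator of \<open>{c..d}\<close> is reached as a pointwise limit of trapezoids with values in
  [0,1], with dominated convergence on both sides of the inequality.\<close>

lemma norm_integral_le_if_pairing_bound:
  fixes u :: "real \<Rightarrow> 'a::euclidean_space"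
  assumes u: "integrable (lebesgue_on {0<..<T}) u" and cd: "0 < c" "c \<le> d" "d < T"
    and bound: "\<And>(\<rho> :: real \<Rightarrow> real) a b. \<lbrakk>continuous_on UNIV \<rho>; 0 < a; a \<le> b; b < T;
      \<And>t. t \<notin> {a<..<b} \<Longrightarrow> \<rho> t = 0\<rbrakk> \<Longrightarrow>
      norm (LINT t|lebesgue_on {0<..<T}. \<rho> t *\<^sub>R u t)
        \<le> K * (LINT t|lebesgue_on {0<..<T}. \<bar>\<rho> t\<bar>)"
  shows "norm (integral {c..d} u) \<le> K * (d - c)"
proof -
  let ?M = "lebesgue_on {0<..<T}"
  \<comment> \<open>The inner maximum is the distance from \<open>t\<close> to
    \<open>{c..d}\<close>, so \<open>\<rho> n\<close> equals 1 on that interval and falls linearly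
    to 0 over the width \<open>1 / real (Suc n)\<close> on each side.\<close>
  define \<rho> :: "nat \<Rightarrow> real \<Rightarrow> real"
    where "\<rho> n t = max 0 (1 - real (Suc n) * max 0 (max (c - t) (t - d)))" for n t
  have cont: "continuous_on UNIV (\<rho> n)" for n unfolding \<rho>_def by (intro continuous_intros)
  have range: "0 \<le> \<rho> n t" "\<rho> n t \<le> 1" for n t by (auto simp: \<rho>_def)
  have lim: "(\<lambda>n. \<rho> n t) \<longlonglongrightarrow> indicator {c..d} t" for t
  proof (cases "t \<in> {c..d}")
    case True
    then show ?thesis by (simp add: \<rho>_def)
  next
    case False
    define m where "m = max 0 (max (c - t) (t - d))"
    have "m > 0" using False by (auto simp: m_def)
    then obtain N where N: "1 < real N * m" using reals_Archimedean3 by blast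
    have "\<rho> n t = 0" if "n \<ge> N" for n
    proof -
      have "real N * m \<le> real (Suc n) * m" using that \<open>m > 0\<close> by (intro mult_right_mono) auto
      then show ?thesis using N by (simp add: \<rho>_def flip: m_def)
    qed
    then have "\<forall>\<^sub>F n in sequentially. \<rho> n t = indicator {c..d} t"
      using False by (auto simp: eventually_sequentially)
    then show ?thesis by (rule tendsto_eventually)
  qed
  have "(\<lambda>n. 1 / real (Suc n)) \<longlonglongrightarrow> 0" by (rule LIMSEQ_Suc[OF lim_1_over_n])
  \<comment> \<open>From here on the ramps fit into (0,T), which is where the assumed bound
    applies.\<close>
  then have small: "\<forall>\<^sub>F n in sequentially. 1 / real (Suc n) < min c (T - d)"
    by (rule order_tendstoD) (use cd in auto)
  have le: "\<forall>\<^sub>F n in sequentially.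
      norm (LINT t|?M. \<rho> n t *\<^sub>R u t) \<le> K * (LINT t|?M. \<bar>\<rho> n t\<bar>)"
    using small
  proof eventually_elim
    case (elim n)
    define e where "e = 1 / real (Suc n)"
    have e: "e > 0" "e < c" "e < T - d" "real (Suc n) * e = 1" using elim by (auto simp: e_def)
    have "\<rho> n t = 0" if "t \<notin> {c - e<..<d + e}" for t
    proof -
      have "real (Suc n) * e \<le> real (Suc n) * max 0 (max (c - t) (t - d))"
        using that e by (intro mult_left_mono) auto
      then show ?thesis unfolding \<rho>_def e(4) by simp
    qed
    then show ?case by (intro bound[OF cont, of "c - e" "d + e"]) (use e cd in auto)
  qed
  have sub: "{c..d} \<subseteq> {0<..<T}" using cd by auto
  have int_u: "set_integrable lebesgue {0<..<T} u"
    using u by (simp add: set_integrable_def integrable_restrict_space)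
  have lim1: "(\<lambda>n. LINT t|?M. \<rho> n t *\<^sub>R u t) \<longlonglongrightarrow> (LINT t|?M. indicator {c..d} t *\<^sub>R u t)"
  proof (rule integral_dominated_convergence)
    show "integrable ?M (\<lambda>t. norm (u t))" using u by simp
    show "(\<lambda>t. indicator {c..d} t *\<^sub>R u t) \<in> borel_measurable ?M"
    proof (rule borel_measurable_scaleR)
      show "indicator {c..d} \<in> borel_measurable ?M"
        by (intro measurable_restrict_space1 borel_measurable_indicator) simp
    qed (use u in auto)
    show "(\<lambda>t. \<rho> n t *\<^sub>R u t) \<in> borel_measurable ?M" for n
      using integrable_scaleR_continuous[OF cont u] by auto
    show "AE t in ?M. (\<lambda>n. \<rho> n t *\<^sub>R u t) \<longlonglongrightarrow> indicator {c..d} t *\<^sub>R u t"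
      by (intro AE_I2 tendsto_intros lim)
    show "AE t in ?M. norm (\<rho> n t *\<^sub>R u t) \<le> norm (u t)" for n
      using range by (intro AE_I2) (simp add: mult_left_le_one_le)
  qed
  have int1: "integrable ?M (\<lambda>t. 1::real)"
    by (rule continuous_imp_integrable_lebesgue_on) simp
  have lim2: "(\<lambda>n. LINT t|?M. \<bar>\<rho> n t\<bar>) \<longlonglongrightarrow> (LINT t|?M. indicator {c..d} t)"
  proof (rule integral_dominated_convergence[OF _ _ int1])
    show "indicator {c..d} \<in> borel_measurable ?M"
      by (intro measurable_restrict_space1 borel_measurable_indicator) simp
    show "(\<lambda>t. \<bar>\<rho> n t\<bar>) \<in> borel_measurable ?M" for n
      by (intro continuous_imp_measurable_lebesgue_on continuous_intros cont)
    show "AE t in ?M. (\<lambda>n. \<bar>\<rho> n t\<bar>) \<longlonglongrightarrow> indicator {c..d} t"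
      using lim range by (intro AE_I2) simp
    show "AE t in ?M. norm \<bar>\<rho> n t\<bar> \<le> 1" for n using range by (intro AE_I2) simp
  qed
  have "(LINT t|?M. indicator {c..d} t *\<^sub>R u t) = (LINT t:{c..d}|lebesgue. u t)"
    using sub by (auto simp: integral_restrict_space set_lebesgue_integral_def indicator_def
        intro!: Bochner_Integration.integral_cong)
  also have "\<dots> = integral {c..d} u"
    by (rule set_lebesgue_integral_eq_integral(2)[OF set_integrable_subset[OF int_u _ sub]]) simp
  finally have eq1: "(LINT t|?M. indicator {c..d} t *\<^sub>R u t) = integral {c..d} u" .
  have "(LINT t|?M. indicator {c..d} t) = measure ?M {c..d}"
    using sub by (simp add: Int_absorb2 sets_restrict_space_iff)
  also have "\<dots> = d - c" using sub cd by (simp add: measure_restrict_space)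
  finally have eq2: "(LINT t|?M. indicator {c..d} t) = d - c" .
  show ?thesis
    using tendsto_le[OF _ tendsto_mult[OF tendsto_const lim2] tendsto_norm[OF lim1] le]
    unfolding eq1 eq2 by simp
qed

text \<open>The pairing bound controls the averages of \<open>u\<close> over short intervals, which converge to
  \<open>u\<close> almost everywhere by Lebesgue differentiation.\<close>

lemma weak_derivative_imp_bounded:
  assumes "T > 0"
  obtains C where "C \<ge> 0"
    and "\<And>(u :: real \<Rightarrow> 'a::euclidean_space) v. \<lbrakk>u \<in> bochner_L2 T; v \<in> bochner_L2 T;
      has_weak_derivative T u v\<rbrakk> \<Longrightarrow>
      AE t in lebesgue_on {0<..<T}. norm (u t) \<le> C * (norm_L2 T u + norm_L2 T v)"
proof -
  let ?M = "lebesgue_on {0<..<T}"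
  obtain C where C: "C \<ge> 0"
    and bound: "\<And>(u :: real \<Rightarrow> 'a::euclidean_space) v (\<rho> :: real \<Rightarrow> real) a b.
      \<lbrakk>u \<in> bochner_L2 T; v \<in> bochner_L2 T;
      has_weak_derivative T u v; continuous_on UNIV \<rho>; 0 < a; a \<le> b; b < T;
      \<And>t. t \<notin> {a<..<b} \<Longrightarrow> \<rho> t = 0\<rbrakk> \<Longrightarrow>
      norm (LINT t|lebesgue_on {0<..<T}. \<rho> t *\<^sub>R u t)
        \<le> C * (norm_L2 T u + norm_L2 T v) * (LINT t|lebesgue_on {0<..<T}. \<bar>\<rho> t\<bar>)"
    by (rule weak_derivative_pairing_bound[OF assms, where 'a='a]) blast
  show thesis
  proof (rule that[OF C])
    fix u v :: "real \<Rightarrow> 'a"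
    assume u: "u \<in> bochner_L2 T" and v: "v \<in> bochner_L2 T" and weak: "has_weak_derivative T u v"
    define K where "K = C * (norm_L2 T u + norm_L2 T v)"
    note u_int = bochner_L2_imp_integrable[OF u]
    have avg: "norm (integral {c..d} u) \<le> K * (d - c)" if "0 < c" "c \<le> d" "d < T" for c d
      by (rule norm_integral_le_if_pairing_bound[OF u_int that])
         (unfold K_def, rule bound[OF u v weak])
    \<comment> \<open>Extension by zero gives a function integrable on the whole line, as the
      differentiation theorem below requires.\<close>
    define f where "f t = (if t \<in> {0<..<T} then u t else 0)" for t
    have "f integrable_on UNIV"
      unfolding f_def integrable_restrict_UNIV using u_int by (simp add: integrable_on_lebesgue_on)
    then have "f integrable_on cbox a b" for a b by (rule integrable_on_subcbox) simp
    then obtain N where N: "negligible N"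
      "\<And>x e. \<lbrakk>x \<notin> N; 0 < e\<rbrakk> \<Longrightarrow> \<exists>d>0. \<forall>h. 0 < h \<and> h < d \<longrightarrow>
        norm (integral (cbox x (x + h *\<^sub>R One)) f /\<^sub>R h ^ DIM(real) - f x) < e"
      using integrable_ccontinuous_explicit[of f] by blast
    have le: "norm (u x) \<le> K" if x: "x \<in> {0<..<T}" "x \<notin> N" for x
    proof (rule field_le_epsilon)
      fix e :: real assume "e > 0"
      obtain d where d: "d > 0" "\<And>h. 0 < h \<Longrightarrow> h < d \<Longrightarrow>
          norm (integral {x..x + h} f /\<^sub>R h - f x) < e"
        using N(2)[OF x(2) \<open>e > 0\<close>] by auto
      \<comment> \<open>The bound \<open>d\<close> makes the average close to the value at
        \<open>x\<close>; the bound \<open>T - x\<close> keeps \<open>{x..x + h}\<close> inside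
        (0,T), where \<open>f\<close> is \<open>u\<close> and the estimate of averages
        holds.\<close>
      have "0 < min d (T - x)" using d(1) x by simp
      then obtain h where "0 < h" "h < min d (T - x)" using dense by blast
      then have h: "0 < h" "h < d" "x + h < T" by auto
      have "integral {x..x + h} f = integral {x..x + h} u"
        using x h by (intro integral_cong) (auto simp: f_def)
      then have "norm (integral {x..x + h} f /\<^sub>R h) \<le> K"
        using avg[of x "x + h"] x h by (simp add: field_simps)
      moreover have "norm (u x) \<le> norm (integral {x..x + h} f /\<^sub>R h)
          + norm (integral {x..x + h} f /\<^sub>R h - f x)"
        using norm_triangle_sub[of "f x" "integral {x..x + h} f /\<^sub>R h"] x
        by (simp add: f_def norm_minus_commute)
      ultimately show "norm (u x) \<le> K + e" using d(2)[OF h(1,2)] by simp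
    qed
    have "AE t in lebesgue. t \<notin> N"
      using N(1) by (simp add: negligible_iff_null_sets AE_not_in)
    then show "AE t in ?M. norm (u t) \<le> C * (norm_L2 T u + norm_L2 T v)"
      using le by (auto simp: AE_restrict_space_iff simp flip: K_def elim!: eventually_mono)
  qed
qed

section \<open>The Sobolev embedding, and stability under sums and linear maps\<close>

lemma sobolev_H1_D:
  assumes "u \<in> sobolev_H1 T"
  shows "u \<in> bochner_L2 T" and "weak_derivative T u \<in> bochner_L2 T"
    and "has_weak_derivative T u (weak_derivative T u)"
proof -
  have "\<exists>g. g \<in> bochner_L2 T \<and> has_weak_derivative T u g"
    using assms by (auto simp: sobolev_H1_def)
  then show "weak_derivative T u \<in> bochner_L2 T"
    "has_weak_derivative T u (weak_derivative T u)"
    unfolding weak_derivative_def by (metis (mono_tags, lifting) someI_ex)+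
  show "u \<in> bochner_L2 T" using assms by (simp add: sobolev_H1_def)
qed

lemma norm_H1_nonneg: "norm_H1 T u \<ge> 0"
  by (simp add: norm_H1_def)

text \<open>Each of the two \<open>L\<^sup>2\<close> seminorms is at most the
  \<open>H\<^sup>1\<close> seminorm, which doubles the constant.\<close>

lemma sobolev_embedding_H1:
  assumes "T > 0"
  obtains C where "C \<ge> 0"
    and "\<And>u :: real \<Rightarrow> 'a::euclidean_space. u \<in> sobolev_H1 T \<Longrightarrow>
      AE t in lebesgue_on {0<..<T}. norm (u t) \<le> C * norm_H1 T u"
proof -
  obtain C where C: "C \<ge> 0"
    and bound: "\<And>(u :: real \<Rightarrow> 'a) v. \<lbrakk>u \<in> bochner_L2 T; v \<in> bochner_L2 T;
      has_weak_derivative T u v\<rbrakk> \<Longrightarrow>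
      AE t in lebesgue_on {0<..<T}. norm (u t) \<le> C * (norm_L2 T u + norm_L2 T v)"
    by (rule weak_derivative_imp_bounded[OF assms, where 'a='a]) blast
  show thesis
  proof (rule that)
    show "2 * C \<ge> 0" using C by simp
    fix u :: "real \<Rightarrow> 'a" assume u: "u \<in> sobolev_H1 T"
    have "norm_L2 T u \<le> norm_H1 T u" "norm_L2 T (weak_derivative T u) \<le> norm_H1 T u"
      unfolding norm_H1_def by (simp_all add: real_le_rsqrt)
    then have "C * (norm_L2 T u + norm_L2 T (weak_derivative T u)) \<le> C * (2 * norm_H1 T u)"
      using C by (intro mult_left_mono) auto
    then show "AE t in lebesgue_on {0<..<T}. norm (u t) \<le> 2 * C * norm_H1 T u"
      using bound[OF sobolev_H1_D[OF u]] by (auto elim!: eventually_mono)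
  qed
qed

lemma test_function_continuous:
  assumes "test_function T \<psi>"
  shows "continuous_on UNIV \<psi>" and "continuous_on UNIV (deriv \<psi>)"
proof -
  obtain D where D: "\<And>x. (\<psi> has_vector_derivative D x) (at x)" "continuous_on UNIV D"
    using assms unfolding test_function_def C1_differentiable_on_def by auto
  then have "deriv \<psi> = D"
    by (auto intro!: DERIV_imp_deriv simp: has_real_derivative_iff_has_vector_derivative)
  then show "continuous_on UNIV (deriv \<psi>)" using D(2) by simp
  show "continuous_on UNIV \<psi>"
    using D(1) by (meson continuous_on_vector_derivative has_vector_derivative_at_within)
qed

text \<open>Guarantees that a perturbed path is again admissible, so that the ansatz along it is
  square integrable.\<close>

lemma sobolev_H1_add:
  fixes u v :: "real \<Rightarrow> 'a::euclidean_space"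
  assumes u: "u \<in> sobolev_H1 T" and v: "v \<in> sobolev_H1 T"
  shows "(\<lambda>t. u t + v t) \<in> sobolev_H1 T"
proof -
  note u' = sobolev_H1_D[OF u] and v' = sobolev_H1_D[OF v]
  note int = integrable_scaleR_continuous[OF _ bochner_L2_imp_integrable]
  have "has_weak_derivative T (\<lambda>t. u t + v t)
      (\<lambda>t. weak_derivative T u t + weak_derivative T v t)"
    unfolding has_weak_derivative_def
  proof (intro allI impI)
    fix \<psi> assume \<psi>: "test_function T \<psi>"
    note c = test_function_continuous[OF \<psi>]
    show "(LINT t|lebesgue_on {0<..<T}. deriv \<psi> t *\<^sub>R (u t + v t)) =
      - (LINT t|lebesgue_on {0<..<T}. \<psi> t *\<^sub>R (weak_derivative T u t + weak_derivative T v t))"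
      using u'(3) v'(3) \<psi> int[OF c(2) u'(1)] int[OF c(2) v'(1)] int[OF c(1) u'(2)] int[OF c(1) v'(2)]
      by (simp add: scaleR_add_right has_weak_derivative_def)
  qed
  then show ?thesis
    using u' v' by (auto simp: sobolev_H1_def intro: bochner_L2_add)
qed

text \<open>Bounded linear maps commute with the integral, so the image of a weak derivative is a
  weak derivative. Applied to coordinate projections, it makes the assumptions on scalar paths
  available for the components of \<open>p\<close>.\<close>

lemma sobolev_H1_bounded_linear:
  fixes u :: "real \<Rightarrow> 'a::euclidean_space" and h :: "'a \<Rightarrow> 'b::euclidean_space"
  assumes h: "bounded_linear h" and u: "u \<in> sobolev_H1 T"
  shows "(\<lambda>t. h (u t)) \<in> sobolev_H1 T"
proof -
  interpret h: bounded_linear h by (rule h)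
  note u' = sobolev_H1_D[OF u]
  note int = integrable_scaleR_continuous[OF _ bochner_L2_imp_integrable]
  have "has_weak_derivative T (\<lambda>t. h (u t)) (\<lambda>t. h (weak_derivative T u t))"
    unfolding has_weak_derivative_def
  proof (intro allI impI)
    fix \<psi> assume \<psi>: "test_function T \<psi>"
    note c = test_function_continuous[OF \<psi>]
    show "(LINT t|lebesgue_on {0<..<T}. deriv \<psi> t *\<^sub>R h (u t)) =
      - (LINT t|lebesgue_on {0<..<T}. \<psi> t *\<^sub>R h (weak_derivative T u t))"
      using u'(3) \<psi> integral_bounded_linear[OF h int[OF c(2) u'(1)]]
        integral_bounded_linear[OF h int[OF c(1) u'(2)]]
      by (simp add: has_weak_derivative_def h.scaleR h.neg)
  qed
  then show ?thesis
    using u' bochner_L2_bounded_linear[OF h] by (auto simp: sobolev_H1_def)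
qed

section \<open>Partial derivatives of the cost functional\<close>

text \<open>The sign of the residual is reversed to match the left factor of the inner products in
  the derivative formulas.\<close>

lemma cost_eq: "cost T \<iota> z \<T> \<alpha> p \<phi> = 1/2 * (norm_L2 T (\<lambda>t. ansatz \<iota> \<T> \<alpha> p \<phi> t - \<iota> (z t)))\<^sup>2"
  by (simp add: cost_def norm_L2_def norm_minus_commute)

text \<open>The common frame for coefficients and paths. The derivative is displayed as a sum of
  inner products over the components, while the estimates concern the inner product with the sum;
  the index \<open>i\<close> of \<open>L\<close> keeps both forms at hand.\<close>

lemma has_frechet_derivative_in_half_norm_L2_power2:
  fixes L :: "'i \<Rightarrow> (real \<Rightarrow> 'a::real_normed_vector) \<Rightarrow> real \<Rightarrow> 'x::real_inner"
  assumes w: "w \<in> bochner_L2 T" and "f \<in> V" and "\<And>u. N u \<ge> 0"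
    and L: "\<And>i u. u \<in> V \<Longrightarrow> L i u \<in> bochner_L2 T"
    and L_add: "\<And>i u v. L i (\<lambda>t. u t + v t) = (\<lambda>t. L i u t + L i v t)"
    and L_scaleR: "\<And>i c u. L i (\<lambda>t. c *\<^sub>R u t) = (\<lambda>t. c *\<^sub>R L i u t)"
    and bound: "\<And>u. u \<in> V \<Longrightarrow> norm_L2 T (\<lambda>t. \<Sum>i\<in>I. L i u t) \<le> K * N u"
    and \<Delta>: "\<And>u. u \<in> V \<Longrightarrow> \<Delta> u \<in> bochner_L2 T"
    and little_o: "\<And>\<epsilon>. \<epsilon> > 0 \<Longrightarrow>
      \<exists>\<delta>>0. \<forall>u\<in>V. N u < \<delta> \<longrightarrow> norm_L2 T (\<lambda>t. \<Delta> u t - (\<Sum>i\<in>I. L i u t)) \<le> \<epsilon> * N u"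
    and F: "F f = 1/2 * (norm_L2 T w)\<^sup>2"
      "\<And>u. F (\<lambda>t. f t + u t) = 1/2 * (norm_L2 T (\<lambda>t. w t + \<Delta> u t))\<^sup>2"
  shows "has_frechet_derivative_in F (\<lambda>u. \<Sum>i\<in>I. inner_L2 T w (L i u)) f V N"
proof -
  have sum: "(\<Sum>i\<in>I. inner_L2 T w (L i u)) = inner_L2 T w (\<lambda>t. \<Sum>i\<in>I. L i u t)" if "u \<in> V" for u
    by (rule inner_L2_sum_right[symmetric, OF w L[OF that]])
  have sum_L2: "(\<lambda>t. \<Sum>i\<in>I. L i u t) \<in> bochner_L2 T" if "u \<in> V" for u
    by (rule bochner_L2_sum[OF L[OF that]])
  show ?thesis
    unfolding has_frechet_derivative_in_def
  proof (intro conjI ballI allI impI)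
    show "f \<in> V" by fact
  next
    fix u v assume "u \<in> V" "v \<in> V"
    then show "(\<Sum>i\<in>I. inner_L2 T w (L i (\<lambda>t. u t + v t)))
        = (\<Sum>i\<in>I. inner_L2 T w (L i u)) + (\<Sum>i\<in>I. inner_L2 T w (L i v))"
      by (simp add: L_add inner_L2_add_right w L sum.distrib)
  next
    fix c u
    show "(\<Sum>i\<in>I. inner_L2 T w (L i (\<lambda>t. c *\<^sub>R u t))) = c * (\<Sum>i\<in>I. inner_L2 T w (L i u))"
      by (simp add: L_scaleR inner_L2_scaleR_right sum_distrib_left)
  next
    have "\<bar>inner_L2 T w (\<lambda>t. \<Sum>i\<in>I. L i u t)\<bar> \<le> norm_L2 T w * K * N u" if "u \<in> V" for u
      using order_trans[OF Cauchy_Schwarz_L2[OF w sum_L2[OF that]]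
          mult_left_mono[OF bound[OF that] norm_L2_nonneg]] by (simp add: mult.assoc)
    then show "\<exists>K. \<forall>u\<in>V. \<bar>\<Sum>i\<in>I. inner_L2 T w (L i u)\<bar> \<le> K * N u" using sum by auto
  next
    fix \<epsilon> :: real assume "\<epsilon> > 0"
    obtain \<delta> where \<delta>: "\<delta> > 0" "\<forall>u\<in>V. N u < \<delta> \<longrightarrow>
        \<bar>1/2 * (norm_L2 T (\<lambda>t. w t + \<Delta> u t))\<^sup>2 - 1/2 * (norm_L2 T w)\<^sup>2
          - inner_L2 T w (\<lambda>t. \<Sum>i\<in>I. L i u t)\<bar> \<le> \<epsilon> * N u"
      using half_norm_L2_power2_frechet[where L = "\<lambda>u t. \<Sum>i\<in>I. L i u t",
          OF w \<Delta> sum_L2 assms(3) bound little_o \<open>\<epsilon> > 0\<close>] by blast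
    then show "\<exists>\<delta>>0. \<forall>u\<in>V. N u < \<delta> \<longrightarrow>
        \<bar>F (\<lambda>t. f t + u t) - F f - (\<Sum>i\<in>I. inner_L2 T w (L i u))\<bar> \<le> \<epsilon> * N u"
      unfolding F using sum by (intro exI[of _ \<delta>]) simp
  qed
qed

text \<open>By the mean value inequality the remainder is at most \<open>\<bar>s\<bar>\<close> times
  the oscillation of the derivative between \<open>q\<close> and \<open>q + s\<close>. Uniform
  continuity on a compact interval makes the radius independent of \<open>q\<close>.\<close>

lemma C1_differentiable_on_uniform_remainder:
  fixes f :: "real \<Rightarrow> 'x::real_normed_vector"
  assumes "f C1_differentiable_on UNIV" and "\<epsilon> > 0"
  obtains \<delta> where "\<delta> > 0" and "\<And>q s. \<bar>q\<bar> \<le> R \<Longrightarrow> \<bar>s\<bar> \<le> \<delta> \<Longrightarrow>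
    norm (f (q + s) - f q - s *\<^sub>R vector_derivative f (at q)) \<le> \<epsilon> * \<bar>s\<bar>"
proof -
  define D where "D q = vector_derivative f (at q)" for q
  have D: "(f has_vector_derivative D q) (at q)" for q
    using assms(1) vector_derivative_works unfolding D_def C1_differentiable_on_eq by blast
  \<comment> \<open>The margin 1 leaves room for \<open>q + s\<close>, as
    \<open>\<bar>s\<bar>\<close> will be at most 1.\<close>
  have "continuous_on {- R - 1..R + 1} D"
    using assms(1) continuous_on_subset unfolding D_def C1_differentiable_on_eq by blast
  then have "uniformly_continuous_on {- R - 1..R + 1} D"
    by (intro compact_uniformly_continuous) auto
  then obtain d where d: "d > 0" "\<And>x x'. x \<in> {- R - 1..R + 1} \<Longrightarrow> x' \<in> {- R - 1..R + 1} \<Longrightarrow>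
      dist x' x < d \<Longrightarrow> dist (D x') (D x) < \<epsilon>"
    using \<open>\<epsilon> > 0\<close> unfolding uniformly_continuous_on_def by metis
  show thesis
  proof (rule that)
    \<comment> \<open>Halving \<open>d\<close> yields the strict inequality of uniform continuity
      from a nonstrict bound on \<open>s\<close>.\<close>
    show "min 1 (d / 2) > 0" using d(1) by simp
    fix q s assume q: "\<bar>q\<bar> \<le> R" and s: "\<bar>s\<bar> \<le> min 1 (d / 2)"
    have "norm (f (q + s) - f q - (q + s - q) *\<^sub>R D q) \<le> norm (q + s - q) * \<epsilon>"
    proof (rule vector_differentiable_bound_linearization[where S = "closed_segment q (q + s)"])
      fix x assume "x \<in> closed_segment q (q + s)"
      then have "\<bar>x - q\<bar> \<le> \<bar>s\<bar>"
        by (auto simp: closed_segment_eq_real_ivl split: if_splits)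
      then have "dist (D x) (D q) < \<epsilon>"
        using q s d(1) by (intro d(2)) (auto simp: dist_real_def)
      then show "norm (D x - D q) \<le> \<epsilon>" by (simp add: dist_norm)
    qed (auto intro: has_vector_derivative_at_within D)
    then show "norm (f (q + s) - f q - s *\<^sub>R vector_derivative f (at q)) \<le> \<epsilon> * \<bar>s\<bar>"
      by (simp add: D_def mult.commute)
  qed
qed

text \<open>With \<open>R\<close> bounding the essential range of the path, this makes the
  linearization in the path direction a bounded operator.\<close>

lemma C1_differentiable_on_derivative_bounded:
  fixes f :: "real \<Rightarrow> 'x::real_normed_vector"
  assumes "f C1_differentiable_on UNIV"
  obtains B where "\<And>q. \<bar>q\<bar> \<le> R \<Longrightarrow> norm (vector_derivative f (at q)) \<le> B"
proof -
  have "continuous_on {- R..R} (\<lambda>q. vector_derivative f (at q))"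
    using assms continuous_on_subset unfolding C1_differentiable_on_eq by blast
  then have "bounded ((\<lambda>q. vector_derivative f (at q)) ` {- R..R})"
    by (intro compact_imp_bounded compact_continuous_image) auto
  then show thesis unfolding bounded_iff using that by (metis abs_le_iff atLeastAtMost_iff imageI minus_le_iff)
qed

section \<open>The three partial derivatives\<close>

lemma cost_has_frechet_derivative_coefficients:
  fixes \<alpha> p :: "real \<Rightarrow> real^'r"
  assumes w: "(\<lambda>t. ansatz \<iota> \<T> \<alpha> p \<phi> t - \<iota> (z t)) \<in> bochner_L2 T" and "\<alpha> \<in> bochner_L2 T"
    and L2: "\<And>i a. a \<in> bochner_L2 T \<Longrightarrow>
      (\<lambda>t. a t *\<^sub>R blinfun_apply (\<T> i (p t $ i)) (\<iota> (\<phi> $ i))) \<in> bochner_L2 T"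
    and Linf: "\<And>i. (\<lambda>t. blinfun_apply (\<T> i (p t $ i)) (\<iota> (\<phi> $ i))) \<in> bochner_Linf T"
  shows "has_frechet_derivative_in (\<lambda>\<beta>. cost T \<iota> z \<T> \<beta> p \<phi>)
      (\<lambda>d. \<Sum>i\<in>UNIV. inner_L2 T (\<lambda>t. ansatz \<iota> \<T> \<alpha> p \<phi> t - \<iota> (z t))
        (\<lambda>t. (d t $ i) *\<^sub>R blinfun_apply (\<T> i (p t $ i)) (\<iota> (\<phi> $ i))))
      \<alpha> (bochner_L2 T) (norm_L2 T)"
proof -
  define L where "L i d t = (d t $ i) *\<^sub>R blinfun_apply (\<T> i (p t $ i)) (\<iota> (\<phi> $ i))"
    for i t and d :: "real \<Rightarrow> real^'r"
  have L_L2: "L i d \<in> bochner_L2 T" if "d \<in> bochner_L2 T" for i d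
    unfolding L_def by (rule L2[OF bochner_L2_component[OF that]])
  have sum_L2: "(\<lambda>t. \<Sum>i\<in>UNIV. L i d t) \<in> bochner_L2 T" if "d \<in> bochner_L2 T" for d
    by (rule bochner_L2_sum) (rule L_L2[OF that])
  have "\<exists>C. AE t in lebesgue_on {0<..<T}. norm (blinfun_apply (\<T> i (p t $ i)) (\<iota> (\<phi> $ i))) \<le> C" for i
    using Linf[of i] by (simp add: bochner_Linf_def)
  then obtain C where
    "\<And>i. AE t in lebesgue_on {0<..<T}. norm (blinfun_apply (\<T> i (p t $ i)) (\<iota> (\<phi> $ i))) \<le> C i"
    by metis
  \<comment> \<open>One null set now serves all components, since there are finitely many.\<close>
  then have C: "AE t in lebesgue_on {0<..<T}. \<forall>i.
      norm (blinfun_apply (\<T> i (p t $ i)) (\<iota> (\<phi> $ i))) \<le> C i"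
    by (simp add: AE_all_countable)
  have bound: "norm_L2 T (\<lambda>t. \<Sum>i\<in>UNIV. L i d t) \<le> (\<Sum>i\<in>UNIV. \<bar>C i\<bar>) * norm_L2 T d"
    if d: "d \<in> bochner_L2 T" for d
  proof (rule norm_L2_dominated[OF sum_L2[OF d] d])
    show "AE t in lebesgue_on {0<..<T}. norm (\<Sum>i\<in>UNIV. L i d t) \<le> (\<Sum>i\<in>UNIV. \<bar>C i\<bar>) * norm (d t)"
      using C
    proof eventually_elim
      case (elim t)
      have "norm (L i d t) \<le> \<bar>C i\<bar> * norm (d t)" for i
        using mult_mono[OF component_le_norm_cart order_trans[OF spec[OF elim] abs_ge_self], of "d t" i i]
        by (simp add: L_def mult.commute)
      then show ?case unfolding sum_distrib_right by (rule sum_norm_le)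
    qed
  qed (simp add: sum_nonneg)
  have "has_frechet_derivative_in (\<lambda>\<beta>. cost T \<iota> z \<T> \<beta> p \<phi>)
      (\<lambda>d. \<Sum>i\<in>UNIV. inner_L2 T (\<lambda>t. ansatz \<iota> \<T> \<alpha> p \<phi> t - \<iota> (z t)) (L i d))
      \<alpha> (bochner_L2 T) (norm_L2 T)"
  proof (rule has_frechet_derivative_in_half_norm_L2_power2
      [where \<Delta> = "\<lambda>d t. \<Sum>i\<in>UNIV. L i d t", OF w \<open>\<alpha> \<in> bochner_L2 T\<close> norm_L2_nonneg L_L2 _ _ bound sum_L2])
    show "L i (\<lambda>t. u t + v t) = (\<lambda>t. L i u t + L i v t)" for i u v
      by (simp add: fun_eq_iff L_def scaleR_add_left)
    show "L i (\<lambda>t. c *\<^sub>R u t) = (\<lambda>t. c *\<^sub>R L i u t)" for i c u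
      by (simp add: fun_eq_iff L_def)
    \<comment> \<open>The remainder is identically zero, so the radius 1 serves for every
      \<open>\<epsilon>\<close>.\<close>
    show "\<exists>\<delta>>0. \<forall>u\<in>bochner_L2 T. norm_L2 T u < \<delta> \<longrightarrow>
      norm_L2 T (\<lambda>t. (\<Sum>i\<in>UNIV. L i u t) - (\<Sum>i\<in>UNIV. L i u t)) \<le> \<epsilon> * norm_L2 T u" if "\<epsilon> > 0" for \<epsilon>
      using that by (intro exI[of _ 1]) (simp add: norm_L2_def)
    show "cost T \<iota> z \<T> (\<lambda>t. \<alpha> t + u t) p \<phi> = 1 / 2 *
        (norm_L2 T (\<lambda>t. ansatz \<iota> \<T> \<alpha> p \<phi> t - \<iota> (z t) + (\<Sum>i\<in>UNIV. L i u t)))\<^sup>2" for u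
      unfolding cost_eq by (simp add: ansatz_def L_def scaleR_add_left sum.distrib algebra_simps)
  qed (assumption | rule cost_eq)+
  then show ?thesis unfolding L_def .
qed

text \<open>The ansatz is linear in the modes, so its value at \<open>h\<close> is its own
  linearization. The modes form a normed type, and hence the derivative is the standard
  \<open>has_derivative\<close>.\<close>

lemma cost_has_derivative_modes:
  assumes \<iota>: "bounded_linear \<iota>"
    and w: "(\<lambda>t. ansatz \<iota> \<T> \<alpha> p \<phi> t - \<iota> (z t)) \<in> bochner_L2 T"
    and L2: "\<And>i y. (\<lambda>t. (\<alpha> t $ i) *\<^sub>R blinfun_apply (\<T> i (p t $ i)) (\<iota> y)) \<in> bochner_L2 T"
    and op_norm: "\<And>i. (\<lambda>t. (\<alpha> t $ i) * norm (\<T> i (p t $ i))) \<in> bochner_L2 T"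
  shows "((\<lambda>\<psi>. cost T \<iota> z \<T> \<alpha> p \<psi>) has_derivative
      (\<lambda>h. \<Sum>i\<in>UNIV. inner_L2 T (\<lambda>t. ansatz \<iota> \<T> \<alpha> p \<phi> t - \<iota> (z t))
        (\<lambda>t. (\<alpha> t $ i) *\<^sub>R blinfun_apply (\<T> i (p t $ i)) (\<iota> (h $ i))))) (at \<phi>)"
proof -
  interpret \<iota>: bounded_linear \<iota> by (rule \<iota>)
  let ?w = "\<lambda>t. ansatz \<iota> \<T> \<alpha> p \<phi> t - \<iota> (z t)"
  define D where "D h = (\<Sum>i\<in>UNIV. inner_L2 T ?w
      (\<lambda>t. (\<alpha> t $ i) *\<^sub>R blinfun_apply (\<T> i (p t $ i)) (\<iota> (h $ i))))" for h
  have A_L2: "ansatz \<iota> \<T> \<alpha> p h \<in> bochner_L2 T" for h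
    unfolding ansatz_def by (rule bochner_L2_sum) (rule L2)
  have D: "D h = inner_L2 T ?w (ansatz \<iota> \<T> \<alpha> p h)" for h
    unfolding D_def ansatz_def[of _ _ _ _ h] by (rule inner_L2_sum_right[symmetric, OF w L2])
  have A_add: "ansatz \<iota> \<T> \<alpha> p (g + h) = (\<lambda>t. ansatz \<iota> \<T> \<alpha> p g t + ansatz \<iota> \<T> \<alpha> p h t)" for g h
    by (simp add: ansatz_def \<iota>.add blinfun.add_right scaleR_add_right sum.distrib)
  have A_scaleR: "ansatz \<iota> \<T> \<alpha> p (c *\<^sub>R h) = (\<lambda>t. c *\<^sub>R ansatz \<iota> \<T> \<alpha> p h t)" for c h
    by (simp add: ansatz_def \<iota>.scaleR blinfun.scaleR_right scaleR_sum_right mult.commute)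
  \<comment> \<open>A square integrable majorant that does not depend on \<open>h\<close>: pointwise
    the ansatz at \<open>h\<close> is at most \<open>onorm \<iota> * norm h * H t\<close>. The outer
    norm removes the sign of the coefficient.\<close>
  define H where "H t = (\<Sum>i\<in>UNIV. norm ((\<alpha> t $ i) * norm (\<T> i (p t $ i))))" for t
  have H: "H \<in> bochner_L2 T"
    unfolding H_def by (intro bochner_L2_sum bochner_L2_norm op_norm)
  have bound: "norm_L2 T (ansatz \<iota> \<T> \<alpha> p h) \<le> (onorm \<iota> * norm_L2 T H) * norm h" for h
  proof -
    have "norm_L2 T (ansatz \<iota> \<T> \<alpha> p h) \<le> (onorm \<iota> * norm h) * norm_L2 T H"
    proof (rule norm_L2_dominated[OF A_L2 H])
      have "norm (ansatz \<iota> \<T> \<alpha> p h t) \<le> (onorm \<iota> * norm h) * H t" for t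
        unfolding ansatz_def H_def sum_distrib_left
      proof (rule sum_norm_le)
        fix i
        have "norm (blinfun_apply (\<T> i (p t $ i)) (\<iota> (h $ i))) \<le> norm (\<T> i (p t $ i)) * norm (\<iota> (h $ i))"
          by (rule norm_blinfun)
        also have "\<dots> \<le> norm (\<T> i (p t $ i)) * (onorm \<iota> * norm h)"
          by (intro mult_left_mono order_trans[OF onorm[OF \<iota>]] mult_left_mono Finite_Cartesian_Product.norm_nth_le
              onorm_pos_le[OF \<iota>] norm_ge_zero)
        finally have "\<bar>\<alpha> t $ i\<bar> * norm (blinfun_apply (\<T> i (p t $ i)) (\<iota> (h $ i)))
            \<le> \<bar>\<alpha> t $ i\<bar> * (norm (\<T> i (p t $ i)) * (onorm \<iota> * norm h))"
          by (rule mult_left_mono) simp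
        then show "norm ((\<alpha> t $ i) *\<^sub>R blinfun_apply (\<T> i (p t $ i)) (\<iota> (h $ i)))
            \<le> onorm \<iota> * norm h * norm ((\<alpha> t $ i) * norm (\<T> i (p t $ i)))"
          by (simp add: abs_mult ac_simps)
      qed
      moreover have "H t \<ge> 0" for t by (simp add: H_def sum_nonneg)
      ultimately show "AE t in lebesgue_on {0<..<T}.
          norm (ansatz \<iota> \<T> \<alpha> p h t) \<le> (onorm \<iota> * norm h) * norm (H t)" by simp
    qed (simp add: onorm_pos_le[OF \<iota>])
    then show ?thesis by (simp add: ac_simps)
  qed
  have "bounded_linear D"
  proof (rule bounded_linear_intro)
    show "D (g + h) = D g + D h" for g h
      unfolding D A_add by (rule inner_L2_add_right[OF w A_L2 A_L2])
    show "D (c *\<^sub>R h) = c *\<^sub>R D h" for c h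
      unfolding D A_scaleR by (simp add: inner_L2_scaleR_right)
    show "norm (D h) \<le> norm h * (norm_L2 T ?w * (onorm \<iota> * norm_L2 T H))" for h
      using order_trans[OF Cauchy_Schwarz_L2[OF w A_L2] mult_left_mono[OF bound norm_L2_nonneg], of h]
      by (simp add: D ac_simps)
  qed
  moreover have "\<exists>\<delta>>0. \<forall>\<psi>. norm (\<psi> - \<phi>) < \<delta> \<longrightarrow>
      norm (cost T \<iota> z \<T> \<alpha> p \<psi> - cost T \<iota> z \<T> \<alpha> p \<phi> - D (\<psi> - \<phi>)) \<le> \<epsilon> * norm (\<psi> - \<phi>)"
    if "\<epsilon> > 0" for \<epsilon> :: real
  proof -
    have triv: "\<exists>\<delta>>0. \<forall>u\<in>UNIV. norm u < \<delta> \<longrightarrow>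
      norm_L2 T (\<lambda>t. ansatz \<iota> \<T> \<alpha> p u t - ansatz \<iota> \<T> \<alpha> p u t) \<le> e * norm u" if "e > 0" for e :: real
      using that by (intro exI[of _ 1]) (simp add: norm_L2_def)
    obtain \<delta> where \<delta>: "\<delta> > 0" "\<And>h. norm h < \<delta> \<Longrightarrow>
        \<bar>1/2 * (norm_L2 T (\<lambda>t. ?w t + ansatz \<iota> \<T> \<alpha> p h t))\<^sup>2 - 1/2 * (norm_L2 T ?w)\<^sup>2
          - inner_L2 T ?w (ansatz \<iota> \<T> \<alpha> p h)\<bar> \<le> \<epsilon> * norm h"
      using half_norm_L2_power2_frechet[where N = norm and V = UNIV,
          OF w A_L2 A_L2 norm_ge_zero bound triv \<open>\<epsilon> > 0\<close>] by auto
    have step: "cost T \<iota> z \<T> \<alpha> p \<psi> = 1/2 * (norm_L2 T (\<lambda>t. ?w t + ansatz \<iota> \<T> \<alpha> p (\<psi> - \<phi>) t))\<^sup>2" for \<psi>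
      unfolding cost_eq using A_add[of \<phi> "\<psi> - \<phi>"] by (simp add: algebra_simps)
    show ?thesis
    proof (intro exI[of _ \<delta>] conjI allI impI \<delta>(1))
      fix \<psi> assume "norm (\<psi> - \<phi>) < \<delta>"
      from \<delta>(2)[OF this] show "norm (cost T \<iota> z \<T> \<alpha> p \<psi> - cost T \<iota> z \<T> \<alpha> p \<phi> - D (\<psi> - \<phi>))
          \<le> \<epsilon> * norm (\<psi> - \<phi>)"
        unfolding step[of \<psi>] cost_eq[of T \<iota> z \<T> \<alpha> p \<phi>] D real_norm_def .
    qed
  qed
  ultimately show ?thesis
    unfolding has_derivative_at_alt D_def[symmetric] by blast
qed

lemma cost_has_frechet_derivative_paths:
  fixes \<alpha> p :: "real \<Rightarrow> real^'r"
  assumes "T > 0" and w: "(\<lambda>t. ansatz \<iota> \<T> \<alpha> p \<phi> t - \<iota> (z t)) \<in> bochner_L2 T"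
    and \<alpha>: "\<alpha> \<in> bochner_L2 T" and p: "p \<in> sobolev_H1 T"
    and L2: "\<And>i q. q \<in> sobolev_H1 T \<Longrightarrow>
      (\<lambda>t. (\<alpha> t $ i) *\<^sub>R blinfun_apply (\<T> i (q t)) (\<iota> (\<phi> $ i))) \<in> bochner_L2 T"
    and C1: "\<And>i. (\<lambda>q. blinfun_apply (\<T> i q) (\<iota> (\<phi> $ i))) C1_differentiable_on UNIV"
    and deriv_L2: "\<And>i a. a \<in> bochner_L2 T \<Longrightarrow>
      (\<lambda>t. a t *\<^sub>R path_derivative \<iota> (\<T> i) (p t $ i) (\<phi> $ i)) \<in> bochner_L2 T"
  shows "has_frechet_derivative_in (\<lambda>q. cost T \<iota> z \<T> \<alpha> q \<phi>)
      (\<lambda>g. \<Sum>i\<in>UNIV. inner_L2 T (\<lambda>t. ansatz \<iota> \<T> \<alpha> p \<phi> t - \<iota> (z t))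
        (\<lambda>t. (\<alpha> t $ i * g t $ i) *\<^sub>R path_derivative \<iota> (\<T> i) (p t $ i) (\<phi> $ i)))
      p (sobolev_H1 T) (norm_H1 T)"
proof -
  let ?f = "\<lambda>i q. blinfun_apply (\<T> i q) (\<iota> (\<phi> $ i))"
  let ?D = "\<lambda>i q. path_derivative \<iota> (\<T> i) q (\<phi> $ i)"
  obtain C where C: "C \<ge> 0"
    and embed: "\<And>u :: real \<Rightarrow> real^'r. u \<in> sobolev_H1 T \<Longrightarrow>
      AE t in lebesgue_on {0<..<T}. norm (u t) \<le> C * norm_H1 T u"
    by (rule sobolev_embedding_H1[OF \<open>T > 0\<close>, where 'a = "real^'r"]) blast
  \<comment> \<open>Almost everywhere every component of \<open>p\<close> lies in
    \<open>{- R..R}\<close>.\<close>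
  define R where "R = C * norm_H1 T p"
  have "\<exists>B. \<forall>q. \<bar>q\<bar> \<le> R \<longrightarrow> norm (?D i q) \<le> B" for i
    unfolding path_derivative_def by (rule C1_differentiable_on_derivative_bounded[OF C1]) blast
  then obtain B where B: "\<And>i q. \<bar>q\<bar> \<le> R \<Longrightarrow> norm (?D i q) \<le> B i" by metis
  define L where "L i g t = (\<alpha> t $ i * g t $ i) *\<^sub>R ?D i (p t $ i)"
    for i t and g :: "real \<Rightarrow> real^'r"
  define \<Delta> where "\<Delta> g t = ansatz \<iota> \<T> \<alpha> (\<lambda>t. p t + g t) \<phi> t - ansatz \<iota> \<T> \<alpha> p \<phi> t" for g t
  \<comment> \<open>The product \<open>\<alpha>\<^sub>i g\<^sub>i\<close> is again a square
    integrable coefficient, because \<open>g\<close> is essentially bounded by the embedding; the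
    assumption on the derivative is applied with it.\<close>
  have L_L2: "L i g \<in> bochner_L2 T" if g: "g \<in> sobolev_H1 T" for i g
    unfolding L_def
  proof (rule deriv_L2, rule bochner_L2_dominated[OF _ \<alpha>])
    show "strongly_measurable (lebesgue_on {0<..<T}) (\<lambda>t. \<alpha> t $ i * g t $ i)"
      using strongly_measurable_scaleR[OF
          bochner_L2_imp_strongly_measurable[OF bochner_L2_component[OF \<alpha>, of i]]
          bochner_L2_imp_strongly_measurable[OF bochner_L2_component[OF sobolev_H1_D(1)[OF g], of i]]]
      by simp
    show "AE t in lebesgue_on {0<..<T}. norm (\<alpha> t $ i * g t $ i) \<le> C * norm_H1 T g * norm (\<alpha> t)"
      using embed[OF g]
    proof eventually_elim
      case (elim t)
      then have "\<bar>\<alpha> t $ i\<bar> * \<bar>g t $ i\<bar> \<le> norm (\<alpha> t) * (C * norm_H1 T g)"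
        by (intro mult_mono component_le_norm_cart order_trans[OF component_le_norm_cart]) auto
      then show ?case by (simp add: abs_mult mult.commute)
    qed
  qed
  have sum_L2: "(\<lambda>t. \<Sum>i\<in>UNIV. L i g t) \<in> bochner_L2 T" if "g \<in> sobolev_H1 T" for g
    by (rule bochner_L2_sum) (rule L_L2[OF that])
  have ansatz_L2: "ansatz \<iota> \<T> \<alpha> q \<phi> \<in> bochner_L2 T" if "q \<in> sobolev_H1 T" for q
    unfolding ansatz_def
    by (rule bochner_L2_sum, rule L2, rule sobolev_H1_bounded_linear[OF bounded_linear_vec_nth that])
  have \<Delta>_L2: "\<Delta> g \<in> bochner_L2 T" if "g \<in> sobolev_H1 T" for g
    unfolding \<Delta>_def by (intro bochner_L2_diff ansatz_L2 sobolev_H1_add p that)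
  have bound: "norm_L2 T (\<lambda>t. \<Sum>i\<in>UNIV. L i g t)
      \<le> ((\<Sum>i\<in>UNIV. \<bar>B i\<bar>) * C * norm_L2 T \<alpha>) * norm_H1 T g" if g: "g \<in> sobolev_H1 T" for g
  proof -
    have "norm_L2 T (\<lambda>t. \<Sum>i\<in>UNIV. L i g t)
        \<le> (\<Sum>i\<in>UNIV. C * norm_H1 T g * \<bar>B i\<bar>) * norm_L2 T \<alpha>"
    proof (rule norm_L2_dominated[OF sum_L2[OF g] \<alpha>])
      show "AE t in lebesgue_on {0<..<T}. norm (\<Sum>i\<in>UNIV. L i g t)
          \<le> (\<Sum>i\<in>UNIV. C * norm_H1 T g * \<bar>B i\<bar>) * norm (\<alpha> t)"
        using embed[OF g] embed[OF p]
      proof eventually_elim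
        case (elim t)
        have "norm (L i g t) \<le> C * norm_H1 T g * \<bar>B i\<bar> * norm (\<alpha> t)" for i
        proof -
          have "\<bar>p t $ i\<bar> \<le> R" unfolding R_def by (rule order_trans[OF component_le_norm_cart elim(2)])
          then have "norm (?D i (p t $ i)) \<le> \<bar>B i\<bar>" using B order_trans abs_ge_self by blast
          then have "\<bar>\<alpha> t $ i\<bar> * \<bar>g t $ i\<bar> * norm (?D i (p t $ i))
              \<le> norm (\<alpha> t) * (C * norm_H1 T g) * \<bar>B i\<bar>"
            by (intro mult_mono component_le_norm_cart order_trans[OF component_le_norm_cart elim(1)])
               (auto simp: C norm_H1_nonneg)
          then show ?thesis by (simp add: L_def abs_mult ac_simps)
        qed
        then show ?case unfolding sum_distrib_right by (rule sum_norm_le)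
      qed
    qed (intro sum_nonneg mult_nonneg_nonneg C norm_H1_nonneg abs_ge_zero)
    also have "\<dots> = ((\<Sum>i\<in>UNIV. \<bar>B i\<bar>) * C * norm_L2 T \<alpha>) * norm_H1 T g"
      by (simp add: mult.commute mult.left_commute flip: sum_distrib_left)
    finally show ?thesis .
  qed
  have little_o: "\<exists>\<delta>>0. \<forall>g\<in>sobolev_H1 T. norm_H1 T g < \<delta> \<longrightarrow>
      norm_L2 T (\<lambda>t. \<Delta> g t - (\<Sum>i\<in>UNIV. L i g t)) \<le> \<epsilon> * norm_H1 T g" if "\<epsilon> > 0" for \<epsilon>
  proof -
    \<comment> \<open>Adding one remainder of relative size \<open>\<epsilon> / c\<close> per
      component, each weighted by \<open>\<alpha>\<close>, costs
      \<open>\<epsilon> * norm_H1 T g\<close> times \<open>(c - 1) / c\<close>. The summand 1 keeps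
      \<open>c\<close> positive.\<close>
    define c where "c = real CARD('r) * C * norm_L2 T \<alpha> + 1"
    have c: "c > 0" using C by (auto simp: c_def norm_L2_nonneg intro!: add_nonneg_pos)
    have "\<exists>\<delta>>0. \<forall>q s. \<bar>q\<bar> \<le> R \<longrightarrow> \<bar>s\<bar> \<le> \<delta> \<longrightarrow>
        norm (?f i (q + s) - ?f i q - s *\<^sub>R ?D i q) \<le> \<epsilon> / c * \<bar>s\<bar>" for i
      unfolding path_derivative_def
      by (rule C1_differentiable_on_uniform_remainder[OF C1, of "\<epsilon> / c" R])
         (use that c in \<open>simp, blast\<close>)
    then obtain \<delta> where \<delta>: "\<And>i. \<delta> i > 0"
      "\<And>i q s. \<bar>q\<bar> \<le> R \<Longrightarrow> \<bar>s\<bar> \<le> \<delta> i \<Longrightarrow>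
        norm (?f i (q + s) - ?f i q - s *\<^sub>R ?D i q) \<le> \<epsilon> / c * \<bar>s\<bar>" by metis
    define m where "m = Min (range \<delta>)"
    have m: "m > 0" "\<And>i. m \<le> \<delta> i" using \<delta>(1) by (auto simp: m_def)
    \<comment> \<open>The radius \<open>m / (C + 1)\<close> makes sense even for
      \<open>C = 0\<close> and forces the components of \<open>g\<close> below every
      \<open>\<delta> i\<close> almost everywhere.\<close>
    have "norm_L2 T (\<lambda>t. \<Delta> g t - (\<Sum>i\<in>UNIV. L i g t)) \<le> \<epsilon> * norm_H1 T g"
      if g: "g \<in> sobolev_H1 T" "norm_H1 T g < m / (C + 1)" for g
    proof -
      have "C * norm_H1 T g \<le> (C + 1) * norm_H1 T g" by (simp add: distrib_right norm_H1_nonneg)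
      also have "\<dots> \<le> m" using g(2) C by (simp add: field_simps)
      finally have small: "C * norm_H1 T g \<le> m" .
      have "norm_L2 T (\<lambda>t. \<Delta> g t - (\<Sum>i\<in>UNIV. L i g t))
          \<le> (real CARD('r) * (\<epsilon> / c * (C * norm_H1 T g))) * norm_L2 T \<alpha>"
      proof (rule norm_L2_dominated[OF bochner_L2_diff[OF \<Delta>_L2[OF g(1)] sum_L2[OF g(1)]] \<alpha>])
        show "AE t in lebesgue_on {0<..<T}. norm (\<Delta> g t - (\<Sum>i\<in>UNIV. L i g t))
            \<le> (real CARD('r) * (\<epsilon> / c * (C * norm_H1 T g))) * norm (\<alpha> t)"
          using embed[OF g(1)] embed[OF p]
        proof eventually_elim
          case (elim t)
          let ?r = "\<lambda>i. ?f i (p t $ i + g t $ i) - ?f i (p t $ i) - (g t $ i) *\<^sub>R ?D i (p t $ i)"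
          have r: "norm ((\<alpha> t $ i) *\<^sub>R ?r i) \<le> norm (\<alpha> t) * (\<epsilon> / c * (C * norm_H1 T g))" for i
          proof -
            have p_le: "\<bar>p t $ i\<bar> \<le> R"
              unfolding R_def by (rule order_trans[OF component_le_norm_cart elim(2)])
            have g_le: "\<bar>g t $ i\<bar> \<le> C * norm_H1 T g"
              by (rule order_trans[OF component_le_norm_cart elim(1)])
            have "norm (?r i) \<le> \<epsilon> / c * \<bar>g t $ i\<bar>"
              using g_le small m(2)[of i] by (intro \<delta>(2) p_le) auto
            also have "\<dots> \<le> \<epsilon> / c * (C * norm_H1 T g)"
              using g_le \<open>\<epsilon> > 0\<close> c by (intro mult_left_mono) auto
            finally show ?thesis
              unfolding norm_scaleR real_norm_def
              by (intro mult_mono component_le_norm_cart) auto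
          qed
          have "\<Delta> g t - (\<Sum>i\<in>UNIV. L i g t) = (\<Sum>i\<in>UNIV. (\<alpha> t $ i) *\<^sub>R ?r i)"
            by (simp add: \<Delta>_def L_def ansatz_def scaleR_diff_right sum_subtractf)
          also have "norm \<dots> \<le> (\<Sum>i\<in>(UNIV :: 'r set). norm (\<alpha> t) * (\<epsilon> / c * (C * norm_H1 T g)))"
            by (rule sum_norm_le) (rule r)
          finally show ?case by (simp add: ac_simps)
        qed
      qed (use \<open>\<epsilon> > 0\<close> C c in \<open>simp add: norm_H1_nonneg\<close>)
      also have "\<dots> = (\<epsilon> * norm_H1 T g) * ((c - 1) / c)" by (simp add: c_def)
      also have "\<dots> \<le> (\<epsilon> * norm_H1 T g) * 1"
        using \<open>\<epsilon> > 0\<close> c by (intro mult_left_mono) (auto simp: norm_H1_nonneg)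
      finally show ?thesis by simp
    qed
    then show ?thesis using m(1) C by (intro exI[of _ "m / (C + 1)"]) auto
  qed
  have "has_frechet_derivative_in (\<lambda>q. cost T \<iota> z \<T> \<alpha> q \<phi>)
      (\<lambda>g. \<Sum>i\<in>UNIV. inner_L2 T (\<lambda>t. ansatz \<iota> \<T> \<alpha> p \<phi> t - \<iota> (z t)) (L i g))
      p (sobolev_H1 T) (norm_H1 T)"
  proof (rule has_frechet_derivative_in_half_norm_L2_power2
      [where \<Delta> = \<Delta>, OF w p norm_H1_nonneg L_L2 _ _ bound \<Delta>_L2 little_o])
    show "L i (\<lambda>t. u t + v t) = (\<lambda>t. L i u t + L i v t)" for i u v
      by (simp add: fun_eq_iff L_def distrib_left scaleR_add_left)
    show "L i (\<lambda>t. c *\<^sub>R u t) = (\<lambda>t. c *\<^sub>R L i u t)" for i c u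
      by (simp add: fun_eq_iff L_def mult.left_commute)
    show "cost T \<iota> z \<T> \<alpha> (\<lambda>t. p t + u t) \<phi> = 1 / 2 *
        (norm_L2 T (\<lambda>t. ansatz \<iota> \<T> \<alpha> p \<phi> t - \<iota> (z t) + \<Delta> u t))\<^sup>2" for u
      unfolding cost_eq \<Delta>_def by simp
  qed (assumption | rule cost_eq)+
  then show ?thesis unfolding L_def .
qed

theorem theorem7:
  fixes T :: real
    and \<iota> :: "'y::banach \<Rightarrow> 'x::{real_inner, complete_space}"
    and z :: "real \<Rightarrow> 'y"
    and \<T> :: "'r::finite \<Rightarrow> real \<Rightarrow> 'x \<Rightarrow>\<^sub>L 'x"
    and \<alpha> p :: "real \<Rightarrow> real^'r"
    and \<phi> :: "'y^'r"
  assumes "T > 0"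
    and "reflexive_space TYPE('y)"
    and "dense_inclusion \<iota>"
    and "z \<in> bochner_L2 T"
    and A1_invariant: "\<And>i q. blinfun_apply (\<T> i q) ` range \<iota> \<subseteq> range \<iota>"
    and A1_continuous: "\<And>i y. continuous_on UNIV (\<lambda>q. blinfun_apply (\<T> i q) (\<iota> y))"
    and A2: "\<And>i a q y. a \<in> bochner_L2 T \<Longrightarrow> q \<in> sobolev_H1 T \<Longrightarrow>
      (\<lambda>t. a t *\<^sub>R blinfun_apply (\<T> i (q t)) (\<iota> y)) \<in> bochner_L2 T"
    and A3_C1: "\<And>i y. (\<lambda>q. blinfun_apply (\<T> i q) (\<iota> y)) C1_differentiable_on UNIV"
    and A3_L2: "\<And>i a q y. a \<in> bochner_L2 T \<Longrightarrow> q \<in> sobolev_H1 T \<Longrightarrow>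
      (\<lambda>t. a t *\<^sub>R path_derivative \<iota> (\<T> i) (q t) y) \<in> bochner_L2 T"
    and "\<alpha> \<in> bochner_L2 T" and "p \<in> sobolev_H1 T"
    and "\<And>i. (\<lambda>t. blinfun_apply (\<T> i (p t $ i)) (\<iota> (\<phi> $ i))) \<in> bochner_Linf T"
    and "\<And>i. (\<lambda>t. (\<alpha> t $ i) * norm (\<T> i (p t $ i))) \<in> bochner_L2 T"
  shows "has_frechet_derivative_in
      (\<lambda>\<beta>. cost T \<iota> z \<T> \<beta> p \<phi>)
      (\<lambda>d. \<Sum>i\<in>UNIV. inner_L2 T (\<lambda>t. ansatz \<iota> \<T> \<alpha> p \<phi> t - \<iota> (z t))
        (\<lambda>t. (d t $ i) *\<^sub>R blinfun_apply (\<T> i (p t $ i)) (\<iota> (\<phi> $ i))))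
      \<alpha> (bochner_L2 T) (norm_L2 T)
    \<and> has_frechet_derivative_in
      (\<lambda>q. cost T \<iota> z \<T> \<alpha> q \<phi>)
      (\<lambda>g. \<Sum>i\<in>UNIV. inner_L2 T (\<lambda>t. ansatz \<iota> \<T> \<alpha> p \<phi> t - \<iota> (z t))
        (\<lambda>t. (\<alpha> t $ i * g t $ i) *\<^sub>R path_derivative \<iota> (\<T> i) (p t $ i) (\<phi> $ i)))
      p (sobolev_H1 T) (norm_H1 T)
    \<and> ((\<lambda>\<psi>. cost T \<iota> z \<T> \<alpha> p \<psi>) has_derivative
      (\<lambda>h. \<Sum>i\<in>UNIV. inner_L2 T (\<lambda>t. ansatz \<iota> \<T> \<alpha> p \<phi> t - \<iota> (z t))
        (\<lambda>t. (\<alpha> t $ i) *\<^sub>R blinfun_apply (\<T> i (p t $ i)) (\<iota> (h $ i))))) (at \<phi>)"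
proof -
  have "bounded_linear \<iota>" using \<open>dense_inclusion \<iota>\<close> by (simp add: dense_inclusion_def)
  have \<alpha>_L2: "(\<lambda>t. \<alpha> t $ i) \<in> bochner_L2 T" for i
    by (rule bochner_L2_component[OF \<open>\<alpha> \<in> bochner_L2 T\<close>])
  have p_H1: "(\<lambda>t. p t $ i) \<in> sobolev_H1 T" for i
    by (rule sobolev_H1_bounded_linear[OF bounded_linear_vec_nth \<open>p \<in> sobolev_H1 T\<close>])
  \<comment> \<open>All three derivatives pair against this residual. The data enter through the
    continuity of the inclusion.\<close>
  have w: "(\<lambda>t. ansatz \<iota> \<T> \<alpha> p \<phi> t - \<iota> (z t)) \<in> bochner_L2 T"
  proof (rule bochner_L2_diff)
    show "ansatz \<iota> \<T> \<alpha> p \<phi> \<in> bochner_L2 T"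
      unfolding ansatz_def by (intro bochner_L2_sum A2 \<alpha>_L2 p_H1)
    show "(\<lambda>t. \<iota> (z t)) \<in> bochner_L2 T"
      by (rule bochner_L2_bounded_linear) fact+
  qed
  show ?thesis
  proof (intro conjI)
    show "has_frechet_derivative_in (\<lambda>\<beta>. cost T \<iota> z \<T> \<beta> p \<phi>)
        (\<lambda>d. \<Sum>i\<in>UNIV. inner_L2 T (\<lambda>t. ansatz \<iota> \<T> \<alpha> p \<phi> t - \<iota> (z t))
          (\<lambda>t. (d t $ i) *\<^sub>R blinfun_apply (\<T> i (p t $ i)) (\<iota> (\<phi> $ i))))
        \<alpha> (bochner_L2 T) (norm_L2 T)"
      by (rule cost_has_frechet_derivative_coefficients[OF w \<open>\<alpha> \<in> bochner_L2 T\<close> A2[OF _ p_H1]])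
         (assumption, fact)
    show "has_frechet_derivative_in (\<lambda>q. cost T \<iota> z \<T> \<alpha> q \<phi>)
        (\<lambda>g. \<Sum>i\<in>UNIV. inner_L2 T (\<lambda>t. ansatz \<iota> \<T> \<alpha> p \<phi> t - \<iota> (z t))
          (\<lambda>t. (\<alpha> t $ i * g t $ i) *\<^sub>R path_derivative \<iota> (\<T> i) (p t $ i) (\<phi> $ i)))
        p (sobolev_H1 T) (norm_H1 T)"
      by (rule cost_has_frechet_derivative_paths[OF \<open>T > 0\<close> w \<open>\<alpha> \<in> bochner_L2 T\<close>
            \<open>p \<in> sobolev_H1 T\<close> A2[OF \<alpha>_L2] A3_C1 A3_L2[OF _ p_H1]])
    show "((\<lambda>\<psi>. cost T \<iota> z \<T> \<alpha> p \<psi>) has_derivative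
        (\<lambda>h. \<Sum>i\<in>UNIV. inner_L2 T (\<lambda>t. ansatz \<iota> \<T> \<alpha> p \<phi> t - \<iota> (z t))
          (\<lambda>t. (\<alpha> t $ i) *\<^sub>R blinfun_apply (\<T> i (p t $ i)) (\<iota> (h $ i))))) (at \<phi>)"
      by (rule cost_has_derivative_modes[OF \<open>bounded_linear \<iota>\<close> w A2[OF \<alpha>_L2 p_H1]]) fact
  qed
qed

end
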